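(* Let $X$ be a Banach space, let $p,q_0,q_1\in(1,\infty)$ and let $\gamma_0\in[0,1/q_0')$, $\gamma_1\in[0,1/q_1)$. Suppose that the following conditions hold. (1) There exists a constant $U>0$ such that for all finite families $\mathcal{I}$ of disjoint intervals in $\mathbb{Z}$ and all $f\in\mathscr{P}(\mathbb{T};X)$ with $\widehat f$ supported in $\bigcup_{I\in\mathcal{I}}I$, $$\|f\|_{L^p(\mathbb{T};X)}\le U\,(\#\mathcal{I})^{\gamma_0}\Big(\sum_{I\in\mathcal{I}}\|D_If\|_{L^p(\mathbb{T};X)}^{q_0}\Big)^{1/q_0}.$$ (2) There exists a constant $L>0$ such that for all finite families $\mathcal{I}$ of disjoint intervals in $\mathbb{Z}$ and all $f\in\mathscr{P}(\mathbb{T};X)$ with $\widehat f$ supported in $\bigcup_{I\in\mathcal{I}}I$, $$\Big(\sum_{I\in\mathcal{I}}\|D_If\|_{L^p(\mathbb{T};X)}^{q_1}\Big)^{1/q_1}\le L\,(\#\mathcal{I})^{\gamma_1}\,\|f\|_{L^p(\mathbb{T};X)}.$$ Then for every $K_s$ there exist constants $C,\beta>0$ (depending on $X$, with $p,q_0,q_1,\gamma_0,\gamma_1,U,L$ fixed, and on $K_s$) such that for every $T\in\mathcal{L}(X)$ which is strongly Kreiss bounded with constant $K_s$, $$\|T^n\|\le C\,n^{\frac12\left(\frac1{q_0}-\frac1{q_1}+\gamma_0+\gamma_1\right)}(\log(n+2))^{\beta},\qquad n\ge1.$$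
   Context: Banach spaces are over $\mathbb{C}$; $\mathcal{L}(X)$ is the space of bounded linear operators on $X$; $q'$ denotes the Hölder conjugate of $q$. An operator $T\in\mathcal{L}(X)$ is strongly Kreiss bounded with constant $K_s$ if every $\lambda\in\mathbb{C}$ with $|\lambda|>1$ is in the resolvent set of $T$ and $\|(\lambda-T)^{-n}\|\le K_s(|\lambda|-1)^{-n}$ for all $|\lambda|>1$ and all integers $n\ge1$. Let $\mathbb{T}=[0,1]$ be the torus, $e_n(t)=e^{2\pi i n t}$, and $\widehat f(n)=\int_{\mathbb{T}}f(t)\overline{e_n(t)}\,dt$ for $f\in L^1(\mathbb{T};X)$. Let $\mathscr{P}(\mathbb{T};X)$ be the set of $X$-valued trigonometric polynomials. For an interval $I\subseteq\mathbb{Z}$ (a set of consecutive integers, possibly unbounded) and $f\in\mathscr{P}(\mathbb{T};X)$ put $D_If=\sum_{n\in I}\widehat f(n)e_n$. *)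

theory Defs
  imports "HOL-Analysis.Analysis" "HOL-Library.Disjoint_Sets"
begin

text \<open>
  The distribution only has real Banach spaces (class \<^class>\<open>banach\<close>).  A complex Banach space is
  a real one with a complex scalar multiplication that extends the real one and for which the
  norm is absolutely homogeneous.
\<close>

class complex_banach = banach +
  fixes scaleC :: "complex \<Rightarrow> 'a \<Rightarrow> 'a" (infixr "*\<^sub>C" 75)
  assumes scaleC_add_right: "c *\<^sub>C (x + y) = c *\<^sub>C x + c *\<^sub>C y"
    and scaleC_add_left: "(c + d) *\<^sub>C x = c *\<^sub>C x + d *\<^sub>C x"
    and scaleC_scaleC: "c *\<^sub>C (d *\<^sub>C x) = (c * d) *\<^sub>C x"
    and scaleC_of_real: "complex_of_real r *\<^sub>C x = r *\<^sub>R x"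
    and norm_scaleC: "norm (c *\<^sub>C x) = cmod c * norm x"

instantiation complex :: complex_banach
begin

definition scaleC_complex :: "complex \<Rightarrow> complex \<Rightarrow> complex" where
  "scaleC_complex c x = c * x"

instance
  by standard
    (simp_all add: scaleC_complex_def algebra_simps norm_mult scaleR_conv_of_real)

end

text \<open>Elements of \<open>\<L>(X)\<close> are plain functions; their operator norm is \<^const>\<open>onorm\<close>.\<close>

definition bounded_clinear :: "('a::complex_banach \<Rightarrow> 'a) \<Rightarrow> bool" where
  "bounded_clinear T \<longleftrightarrow> bounded_linear T \<and> (\<forall>c x. T (c *\<^sub>C x) = c *\<^sub>C T x)"

definition shifted :: "('a::complex_banach \<Rightarrow> 'a) \<Rightarrow> complex \<Rightarrow> 'a \<Rightarrow> 'a" where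
  "shifted T \<mu> = (\<lambda>x. \<mu> *\<^sub>C x - T x)"

definition resolvent_set :: "('a::complex_banach \<Rightarrow> 'a) \<Rightarrow> complex set" where
  "resolvent_set T = {\<mu>. bij (shifted T \<mu>) \<and> bounded_clinear (inv (shifted T \<mu>))}"

definition strongly_Kreiss_bounded :: "real \<Rightarrow> ('a::complex_banach \<Rightarrow> 'a) \<Rightarrow> bool" where
  "strongly_Kreiss_bounded K T \<longleftrightarrow>
     (\<forall>\<mu>. cmod \<mu> > 1 \<longrightarrow>
        \<mu> \<in> resolvent_set T \<and>
        (\<forall>n\<ge>1. onorm (inv (shifted T \<mu>) ^^ n) \<le> K / (cmod \<mu> - 1) ^ n))"

definition char_fun :: "int \<Rightarrow> real \<Rightarrow> complex" where
  "char_fun n t = exp (2 * of_real pi * \<i> * of_int n * of_real t)"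

text \<open>
  The vector-valued integral is the Henstock--Kurzweil integral, since the library's Bochner
  integral is confined to second countable (hence separable) spaces.  Both agree on the
  continuous functions considered here.
\<close>

definition fourier_coeff :: "(real \<Rightarrow> 'a::complex_banach) \<Rightarrow> int \<Rightarrow> 'a" where
  "fourier_coeff f n = integral {0..1} (\<lambda>t. cnj (char_fun n t) *\<^sub>C f t)"

definition trig_polys :: "(real \<Rightarrow> 'a::complex_banach) set" where
  "trig_polys = {f. \<exists>N x. finite N \<and> f = (\<lambda>t. \<Sum>n\<in>N. char_fun n t *\<^sub>C x n)}"

definition int_interval :: "int set \<Rightarrow> bool" where
  "int_interval I \<longleftrightarrow> (\<forall>a\<in>I. \<forall>b\<in>I. {a..b} \<subseteq> I)"

definition disjoint_intervals :: "int set set \<Rightarrow> bool" where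
  "disjoint_intervals \<I> \<longleftrightarrow> finite \<I> \<and> disjoint \<I> \<and> (\<forall>I\<in>\<I>. int_interval I)"

text \<open>
  Only the indices with nonzero Fourier coefficient are summed over, because \<open>I\<close> may be infinite
  and \<^const>\<open>sum\<close> is \<open>0\<close> on infinite sets.
\<close>

definition interval_part :: "int set \<Rightarrow> (real \<Rightarrow> 'a::complex_banach) \<Rightarrow> real \<Rightarrow> 'a" where
  "interval_part I f =
     (\<lambda>t. \<Sum>n | n \<in> I \<and> fourier_coeff f n \<noteq> 0. char_fun n t *\<^sub>C fourier_coeff f n)"

definition Lp_norm :: "real \<Rightarrow> (real \<Rightarrow> 'a::complex_banach) \<Rightarrow> real" where
  "Lp_norm p f = (LINT t:{0..1}|lborel. norm (f t) powr p) powr (1 / p)"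

definition hoelder_conj :: "real \<Rightarrow> real" where
  "hoelder_conj q = q / (q - 1)"

end

(*
Fix T and put w(z) = (1 - q)^n (1 - q z T)^(-n) with q = N / (n + N) and n large.  The strong Kreiss
condition bounds w(z) by K on the unit circle, and its coefficients are w_k T^k, where (w_k) is
a negative binomial distribution concentrated on |k - N| <= c sqrt N.

Multiply the orbit polynomial sum_(j < J) e_j T^j x of length J, about sqrt N, by w(e_1): on the
window of frequencies near N this gives v_l T^l x with v_l bounded below and of bounded variation.
Condition (2) makes frequency projections bounded, so the weights v_l can be removed, and the
orbit polynomial over any window of length sqrt N near N is bounded by that over [0, sqrt N].
Gluing sqrt N such windows with (1) yields f(N) <= C N^((1/q0 + g0)/2) f(sqrt N) for the norm f(N)
of the orbit polynomial of length N, hence f(N) = O(N^(1/q0 + g0) (log N)^b).  In the same way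
(2) gives the growth N^(1 - 1/q1 + g1) (log N)^b' for the norm of
sum_(k < N) e_k c_k |-> sum_(k < N) T^(N - 1 - k) c_k, which plays the role of the adjoint orbit.
Composing the two on windows of length sqrt n gives sqrt n T^n, and the theorem follows.
*)
theory Submission
  imports Defs
begin

section \<open>Vector-valued trigonometric polynomials\<close>

text \<open>For large n the weights resemble a Poisson distribution with mean N, and w(z) resembles
  exp (N (z T - 1)). A finite n is convenient because the hypothesis bounds exactly the powers of
  the resolvent, and the factor (1 - q)^n makes the bound independent of n. The obstacle is the
  spread: the kernel moves an orbit by about N but blurs it over sqrt N exponents. A long orbit can
  thus be compared only piecewise with one of length sqrt N, and the exponents a/2 + a/4 + ... of
  the iterated comparison add up to a, with a = 1/q0 + g0 or a = 1 - 1/q1 + g1. The two kinds of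
  polynomials meet at length r about sqrt n, which is the origin of the 1/2 in the theorem: up to
  logarithms, r^(1/q0 + g0) r^(1 - 1/q1 + g1) / r is r^(1/q0 - 1/q1 + g0 + g1). All constants must
  be uniform in T. The kernel depends on T, but only its mass, its spread and its bound are used
  later; even the norm of T, which enters for short lengths, has to be estimated through K.\<close>

lemma scaleC_one [simp]: "1 *\<^sub>C x = (x::'a::complex_banach)"
  using scaleC_of_real[of 1 x] by simp

lemma scaleC_zero_left [simp]: "0 *\<^sub>C x = (0::'a::complex_banach)"
  using scaleC_of_real[of 0 x] by simp

lemma scaleC_zero_right [simp]: "c *\<^sub>C (0::'a::complex_banach) = 0"
  by (metis norm_eq_zero norm_scaleC norm_zero mult_zero_right)

lemma scaleC_scaleR: "c *\<^sub>C (r *\<^sub>R x) = r *\<^sub>R (c *\<^sub>C (x::'a::complex_banach))"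
  by (metis scaleC_of_real scaleC_scaleC mult.commute)

lemma bounded_linear_scaleC_right: "bounded_linear (\<lambda>x::'a::complex_banach. c *\<^sub>C x)"
  by (rule bounded_linear_intro[where K = "cmod c"])
    (auto simp: scaleC_add_right scaleC_scaleR norm_scaleC)

lemma bounded_linear_scaleC_left: "bounded_linear (\<lambda>c. c *\<^sub>C (x::'a::complex_banach))"
proof (rule bounded_linear_intro[where K = "norm x"])
  show "(r *\<^sub>R c) *\<^sub>C x = r *\<^sub>R (c *\<^sub>C x)" for r c
    by (simp add: scaleR_conv_of_real scaleC_of_real flip: scaleC_scaleC)
qed (auto simp: scaleC_add_left norm_scaleC)

lemma scaleC_sum_right: "c *\<^sub>C (\<Sum>i\<in>A. f i) = (\<Sum>i\<in>A. c *\<^sub>C (f i::'a::complex_banach))"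
  by (rule linear_sum[OF bounded_linear.linear[OF bounded_linear_scaleC_right]])

lemma char_fun_add: "char_fun (m + n) t = char_fun m t * char_fun n t"
  by (simp add: char_fun_def algebra_simps flip: exp_add)

lemma cmod_char_fun [simp]: "cmod (char_fun n t) = 1"
  unfolding char_fun_def by (simp add: norm_exp_eq_Re)

lemma char_fun_0 [simp]: "char_fun 0 t = 1"
  by (simp add: char_fun_def)

lemma cnj_char_fun: "cnj (char_fun n t) = char_fun (- n) t"
  unfolding char_fun_def by (simp add: exp_cnj)

lemma char_fun_of_nat: "char_fun (int k) t = char_fun 1 t ^ k"
  by (induction k) (simp_all add: char_fun_add add.commute)

lemma continuous_on_char_fun: "continuous_on S (char_fun n)"
  unfolding char_fun_def by (intro continuous_intros)

lemma continuous_on_scaleC [continuous_intros]: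
  assumes "continuous_on S f"
  shows "continuous_on S (\<lambda>t. f t *\<^sub>C (x::'a::complex_banach))"
  using bounded_linear.continuous_on[OF bounded_linear_scaleC_left assms] .

lemma has_integral_char_fun:
  "(char_fun n has_integral (if n = 0 then 1 else 0)) {0..1}"
proof (cases "n = 0")
  case True
  have "char_fun n = (\<lambda>_. 1)" using True by (intro ext) simp
  then show ?thesis
    using True has_integral_const_real[of "1::complex" 0 1] by simp
next
  case False
  define c where "c = 2 * of_real pi * \<i> * of_int n"
  have c: "c \<noteq> 0" using False by (simp add: c_def)
  have d: "((\<lambda>t. exp (c * of_real t) / c) has_vector_derivative char_fun n t) (at t within {0..1})" for t
  proof -
    have "((\<lambda>z. exp (c * z) / c) has_field_derivative exp (c * of_real t)) (at (of_real t))"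
      using c by (auto intro!: derivative_eq_intros)
    from has_vector_derivative_real_field[OF this]
    show ?thesis by (simp add: char_fun_def c_def has_vector_derivative_at_within)
  qed
  have "(char_fun n has_integral (exp (c * of_real 1) / c - exp (c * of_real 0) / c)) {0..1}"
    by (rule fundamental_theorem_of_calculus) (use d in auto)
  moreover have "exp c = 1"
  proof -
    have "c = \<i> * (of_int n * (of_real pi * 2))" by (simp add: c_def)
    then show ?thesis by (simp add: exp_eq_1)
  qed
  ultimately show ?thesis using False by simp
qed

lemma fourier_coeff_sum:
  assumes "finite N"
  shows "fourier_coeff (\<lambda>t. \<Sum>n\<in>N. char_fun n t *\<^sub>C (x n::'a::complex_banach)) m =
    (if m \<in> N then x m else 0)"
proof -
  have 1: "((\<lambda>t. char_fun (n - m) t *\<^sub>C x n) has_integral (if n = m then x n else 0)) {0..1}" for n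
    using has_integral_linear[OF has_integral_char_fun[of "n - m"] bounded_linear_scaleC_left[of "x n"]]
    by (auto simp: o_def if_distrib[of "\<lambda>c. c *\<^sub>C x n"] split: if_splits)
  have "(\<lambda>t. cnj (char_fun m t) *\<^sub>C (\<Sum>n\<in>N. char_fun n t *\<^sub>C x n)) =
      (\<lambda>t. \<Sum>n\<in>N. char_fun (n - m) t *\<^sub>C x n)"
    by (auto simp: scaleC_sum_right scaleC_scaleC cnj_char_fun simp flip: char_fun_add intro!: sum.cong ext)
  moreover have "((\<lambda>t. \<Sum>n\<in>N. char_fun (n - m) t *\<^sub>C x n) has_integral
      (\<Sum>n\<in>N. if n = m then x n else 0)) {0..1}"
    by (intro has_integral_sum assms 1)
  ultimately show ?thesis
    unfolding fourier_coeff_def using assms by (simp add: integral_unique)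
qed

lemma interval_part_sum:
  assumes "finite N"
  shows "interval_part I (\<lambda>t. \<Sum>n\<in>N. char_fun n t *\<^sub>C (x n::'a::complex_banach)) =
    (\<lambda>t. \<Sum>n\<in>N \<inter> I. char_fun n t *\<^sub>C x n)"
proof -
  have "{n. n \<in> I \<and> (if n \<in> N then x n else 0) \<noteq> 0} = {n \<in> N \<inter> I. x n \<noteq> 0}"
    by auto
  moreover have "(\<Sum>n | n \<in> N \<inter> I \<and> x n \<noteq> 0. char_fun n t *\<^sub>C (if n \<in> N then x n else 0)) =
      (\<Sum>n\<in>N \<inter> I. char_fun n t *\<^sub>C x n)" for t
    using assms by (intro sum.mono_neutral_cong_left) auto
  ultimately show ?thesis
    unfolding interval_part_def fourier_coeff_sum[OF assms] by simp
qed

section \<open>Convexity of powers and L^p norms of continuous functions\<close>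

lemma powr_convex_nonneg:
  assumes "1 \<le> p"
  shows "convex_on {0..} (\<lambda>x::real. x powr p)"
proof (rule convex_onI)
  fix t x y :: real
  assume t: "0 < t" "t < 1" and xy: "x \<in> {0..}" "y \<in> {0..}"
  have le: "r powr p \<le> r" if "0 < r" "r < 1" for r :: real
    using powr_mono'[of 1 p r] assms that by simp
  show "((1 - t) *\<^sub>R x + t *\<^sub>R y) powr p \<le> (1 - t) * x powr p + t * y powr p"
  proof (cases "x = 0 \<or> y = 0")
    \<comment> \<open>At the endpoint 0 the claim reduces to \<open>r powr p \<le> r\<close> for
      \<open>0 < r < 1\<close>.\<close>
    case True
    then show ?thesis
      using t xy le[of t] le[of "1 - t"]
      by (auto simp: powr_mult intro!: mult_right_mono)
  next
    case False
    then show ?thesis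
      using convex_onD[OF powr_convex[OF assms], of t x y] t xy by simp
  qed
qed simp

text \<open>Jensen's inequality for \<open>x powr q\<close> with equal weights. It turns the sum of
  q1-th powers in condition (2) into a plain sum of block norms, at the cost of the factor
  \<open>m powr (1 - 1 / q1)\<close>.\<close>

lemma sum_le_power_mean:
  fixes a :: "nat \<Rightarrow> real"
  assumes "1 \<le> q" "\<And>i. i < m \<Longrightarrow> 0 \<le> a i" "0 < m"
  shows "(\<Sum>i<m. a i) \<le> real m powr (1 - 1 / q) * (\<Sum>i<m. a i powr q) powr (1 / q)"
proof -
  have "(\<Sum>i<m. (1 / real m) *\<^sub>R a i) powr q \<le> (\<Sum>i<m. (1 / real m) * a i powr q)"
    by (rule convex_on_sum[OF _ _ powr_convex_nonneg[OF assms(1)]]) (use assms in auto)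
  then have "((1 / real m) * (\<Sum>i<m. a i)) powr q \<le> (1 / real m) * (\<Sum>i<m. a i powr q)"
    by (simp add: sum_distrib_left sum_divide_distrib)
  then have "(((1 / real m) * (\<Sum>i<m. a i)) powr q) powr (1/q) \<le> ((1 / real m) * (\<Sum>i<m. a i powr q)) powr (1/q)"
    by (rule powr_mono2[rotated 2]) (use assms in auto)
  moreover have nn: "0 \<le> (\<Sum>i<m. a i)" by (intro sum_nonneg) (use assms in auto)
  ultimately have "(1 / real m) * (\<Sum>i<m. a i) \<le> (1 / real m) powr (1/q) * (\<Sum>i<m. a i powr q) powr (1/q)"
    using assms powr_mult[of "1 / real m" "\<Sum>i<m. a i powr q" "1/q"] by (simp add: powr_powr)
  then have "(\<Sum>i<m. a i) \<le> real m * ((1 / real m) powr (1/q) * (\<Sum>i<m. a i powr q) powr (1/q))"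
    using assms by (simp add: field_simps)
  also have "real m * (1 / real m) powr (1/q) = real m powr (1 - 1/q)"
    using assms by (simp add: powr_diff powr_divide)
  then have "real m * ((1 / real m) powr (1/q) * (\<Sum>i<m. a i powr q) powr (1/q)) =
     real m powr (1 - 1/q) * (\<Sum>i<m. a i powr q) powr (1/q)" by simp
  finally show ?thesis .
qed

lemma set_integrable_norm_powr:
  fixes f :: "real \<Rightarrow> 'a::complex_banach"
  assumes "0 < p" "continuous_on {0..1} f"
  shows "set_integrable lborel {0..1} (\<lambda>t. norm (f t) powr p)"
  by (rule borel_integrable_atLeastAtMost',
      rule continuous_on_powr'[OF continuous_on_norm[OF assms(2)] continuous_on_const])
    (use assms in auto)

lemma Lp_norm_nonneg [simp]: "0 \<le> Lp_norm p f"
  by (simp add: Lp_norm_def)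

lemma set_integral_powr_nonneg: "0 \<le> (LINT t:S|M. g t powr (p::real))"
  unfolding set_lebesgue_integral_def by (rule Bochner_Integration.integral_nonneg) auto

lemma Lp_norm_powr:
  assumes "0 < p"
  shows "Lp_norm p f powr p = (LINT t:{0..1}|lborel. norm (f t) powr p)"
  using assms set_integral_powr_nonneg[of lborel "{0..1}" "\<lambda>t. norm (f t)" p]
  by (simp add: Lp_norm_def powr_powr)

lemma Lp_norm_mono:
  fixes f g :: "real \<Rightarrow> 'a::complex_banach"
  assumes "0 < p" "continuous_on {0..1} f" "continuous_on {0..1} g" "0 \<le> C"
    and le: "\<And>t. t \<in> {0..1} \<Longrightarrow> norm (f t) \<le> C * norm (g t)"
  shows "Lp_norm p f \<le> C * Lp_norm p g"
proof -
  have "(LINT t:{0..1}|lborel. norm (f t) powr p) \<le> (LINT t:{0..1}|lborel. C powr p * norm (g t) powr p)"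
    using assms by (intro set_integral_mono set_integrable_norm_powr set_integrable_mult_right)
      (auto simp flip: powr_mult intro!: powr_mono2)
  then have "Lp_norm p f \<le> (C powr p * (LINT t:{0..1}|lborel. norm (g t) powr p)) powr (1/p)"
    unfolding Lp_norm_def using assms(1)
    by (intro powr_mono2 set_integral_powr_nonneg) auto
  also have "\<dots> = C * Lp_norm p g"
    unfolding Lp_norm_def using assms by (subst powr_mult) (auto simp: powr_powr)
  finally show ?thesis .
qed

lemma Lp_norm_const:
  assumes "0 < p" "\<And>t. norm (f t) = c"
  shows "Lp_norm p f = c"
  unfolding Lp_norm_def using assms(1)
  using norm_ge_zero[of "f 0"] unfolding assms(2)
  by (simp add: set_lebesgue_integral_def powr_powr)

text \<open>By convexity of \<open>x \<mapsto> x powr p\<close>, applied to \<open>f + g = \<lambda> (f / \<lambda>) + (1 - \<lambda>) (g / (1 - \<lambda>))\<close>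
  with \<open>\<lambda>\<close> proportional to the norm of \<open>f\<close>.\<close>

lemma Lp_norm_triangle:
  fixes f g :: "real \<Rightarrow> 'a::complex_banach"
  assumes "1 \<le> p" and f: "continuous_on {0..1} f" and g: "continuous_on {0..1} g"
  shows "Lp_norm p (\<lambda>t. f t + g t) \<le> Lp_norm p f + Lp_norm p g"
proof -
  have p: "0 < p" using assms by simp
  \<comment> \<open>The argument divides by the two norms, which may vanish. Positive majorants
    \<open>a\<close> and \<open>b\<close> take their place and are afterwards brought arbitrarily
    close to the norms.\<close>
  have main: "Lp_norm p (\<lambda>t. f t + g t) \<le> a + b"
    if a: "Lp_norm p f \<le> a" "0 < a" and b: "Lp_norm p g \<le> b" "0 < b" for a b
  proof -
    let ?l = "b / (a + b)"
    have l: "0 \<le> ?l" "?l \<le> 1" "1 - ?l = a / (a + b)" using a b by (auto simp: field_simps)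
    have ab: "a + b \<noteq> 0" using a b by simp
    have pt: "norm (f t + g t) powr p \<le>
       (a + b) powr p * ((1 - ?l) * (norm (f t) powr p / a powr p) + ?l * (norm (g t) powr p / b powr p))" for t
    proof -
      have "norm (f t + g t) powr p \<le> (norm (f t) + norm (g t)) powr p"
        using p by (intro powr_mono2 norm_triangle_ineq) auto
      also have "norm (f t) + norm (g t) = (a + b) * ((1 - ?l) *\<^sub>R (norm (f t) / a) + ?l *\<^sub>R (norm (g t) / b))"
        unfolding l(3) using ab a b by (simp add: distrib_left)
      also have "\<dots> powr p = (a + b) powr p * ((1 - ?l) *\<^sub>R (norm (f t) / a) + ?l *\<^sub>R (norm (g t) / b)) powr p"
        by (rule powr_mult)
      also have "\<dots> \<le> (a + b) powr p * ((1 - ?l) * (norm (f t) / a) powr p + ?l * (norm (g t) / b) powr p)"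
        using a b l by (intro mult_left_mono convex_onD[OF powr_convex_nonneg[OF assms(1)]]) auto
      also have "\<dots> = (a + b) powr p * ((1 - ?l) * (norm (f t) powr p / a powr p) + ?l * (norm (g t) powr p / b powr p))"
        using a b by (simp add: powr_divide)
      finally show ?thesis .
    qed
    have fi: "set_integrable lborel {0..1} (\<lambda>t. norm (f t) powr p)"
      and gi: "set_integrable lborel {0..1} (\<lambda>t. norm (g t) powr p)"
      using set_integrable_norm_powr[OF p] f g by auto
    have "(LINT t:{0..1}|lborel. norm (f t + g t) powr p) \<le>
       (LINT t:{0..1}|lborel. (a + b) powr p * ((1 - ?l) * (norm (f t) powr p / a powr p) + ?l * (norm (g t) powr p / b powr p)))"
      by (intro set_integral_mono set_integrable_norm_powr[OF p] continuous_intros f g pt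
         set_integrable_mult_right set_integral_add(1) set_integrable_divide fi gi)
    also have "\<dots> = (a + b) powr p * ((1 - ?l) * (Lp_norm p f powr p / a powr p) + ?l * (Lp_norm p g powr p / b powr p))"
      using fi gi p by (simp add: set_integral_add(2) Lp_norm_powr)
    also have "\<dots> \<le> (a + b) powr p * ((1 - ?l) * 1 + ?l * 1)"
      using a b l p by (intro mult_left_mono add_mono) (auto simp: divide_le_eq_1 intro!: powr_mono2)
    finally have "(LINT t:{0..1}|lborel. norm (f t + g t) powr p) \<le> (a + b) powr p" by simp
    then have "Lp_norm p (\<lambda>t. f t + g t) \<le> ((a + b) powr p) powr (1/p)"
      unfolding Lp_norm_def using p by (intro powr_mono2 set_integral_powr_nonneg) auto
    then show ?thesis using p a b by (simp add: powr_powr)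
  qed
  show ?thesis
  proof (rule field_le_epsilon)
    fix e :: real assume e: "0 < e"
    then show "Lp_norm p (\<lambda>t. f t + g t) \<le> Lp_norm p f + Lp_norm p g + e"
      using main[of "Lp_norm p f + e / 2" "Lp_norm p g + e / 2"]
        Lp_norm_nonneg[of p f] Lp_norm_nonneg[of p g] by force
  qed
qed

lemma Lp_norm_scaleR:
  fixes f :: "real \<Rightarrow> 'a::complex_banach"
  assumes "0 < p" "continuous_on {0..1} f"
  shows "Lp_norm p (\<lambda>t. c *\<^sub>R f t) \<le> \<bar>c\<bar> * Lp_norm p f"
  using assms by (auto intro!: Lp_norm_mono continuous_intros)

lemma Lp_norm_zero [simp]: "0 < p \<Longrightarrow> Lp_norm p (\<lambda>t. 0) = 0"
  by (intro Lp_norm_const) auto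

lemma Lp_norm_sum:
  fixes f :: "'b \<Rightarrow> real \<Rightarrow> 'a::complex_banach"
  assumes "1 \<le> p" "finite A" "\<And>i. i \<in> A \<Longrightarrow> continuous_on {0..1} (f i)"
  shows "Lp_norm p (\<lambda>t. \<Sum>i\<in>A. f i t) \<le> (\<Sum>i\<in>A. Lp_norm p (f i))"
  using assms(2,3)
proof (induction A rule: finite_induct)
  case (insert a A)
  have "Lp_norm p (\<lambda>t. f a t + (\<Sum>i\<in>A. f i t)) \<le> Lp_norm p (f a) + Lp_norm p (\<lambda>t. \<Sum>i\<in>A. f i t)"
    using insert assms(1) by (intro Lp_norm_triangle continuous_intros) auto
  then show ?case using insert by simp
qed (use assms in simp)

section \<open>Trigonometric polynomials with nonnegative frequencies\<close>

definition trig_sum :: "nat set \<Rightarrow> (nat \<Rightarrow> 'a::complex_banach) \<Rightarrow> real \<Rightarrow> 'a" where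
  "trig_sum A x t = (\<Sum>k\<in>A. char_fun (int k) t *\<^sub>C x k)"

lemma continuous_on_trig_sum [continuous_intros]: "continuous_on S (trig_sum A x)"
  unfolding trig_sum_def by (intro continuous_intros continuous_on_char_fun)

lemma trig_sum_cong: "(\<And>k. k \<in> A \<Longrightarrow> x k = y k) \<Longrightarrow> trig_sum A x = trig_sum A y"
  by (auto simp: trig_sum_def intro!: ext sum.cong)

text \<open>Translating the frequencies multiplies the polynomial by a character, which has modulus
  1 everywhere.\<close>

lemma Lp_norm_trig_sum_shift:
  assumes "0 < p"
  shows "Lp_norm p (trig_sum {a + s..<b + s} x) = Lp_norm p (trig_sum {a..<b} (\<lambda>k. x (k + s)))"
proof -
  have "trig_sum {a + s..<b + s} x t = char_fun (int s) t *\<^sub>C trig_sum {a..<b} (\<lambda>k. x (k + s)) t" for t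
    unfolding trig_sum_def sum.shift_bounds_nat_ivl
    by (auto simp: scaleC_sum_right scaleC_scaleC add.commute simp flip: char_fun_add intro!: sum.cong)
  then show ?thesis by (simp add: Lp_norm_def norm_scaleC)
qed

lemma trig_sum_alt: "trig_sum A x = (\<lambda>t. \<Sum>n\<in>int ` A. char_fun n t *\<^sub>C x (nat n))"
  by (auto simp: trig_sum_def sum.reindex intro!: ext)

lemma trig_sum_in_trig_polys: "finite A \<Longrightarrow> trig_sum A x \<in> trig_polys"
  unfolding trig_sum_alt trig_polys_def by (auto intro!: exI[of _ "int ` A"] exI[of _ "\<lambda>n. x (nat n)"])

lemma spectrum_trig_sum: "finite A \<Longrightarrow> {n. fourier_coeff (trig_sum A x) n \<noteq> 0} \<subseteq> int ` A"
  unfolding trig_sum_alt by (auto simp: fourier_coeff_sum split: if_splits)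

lemma interval_part_trig_sum:
  assumes "finite A"
  shows "interval_part I (trig_sum A x) = trig_sum {k \<in> A. int k \<in> I} x"
proof -
  have "int ` A \<inter> I = int ` {k \<in> A. int k \<in> I}" by auto
  then show ?thesis
    unfolding trig_sum_alt using assms by (subst interval_part_sum) auto
qed

section \<open>Negative binomial kernels of strongly Kreiss bounded operators\<close>

lemma bounded_linear_funpow:
  fixes f :: "'a::real_normed_vector \<Rightarrow> 'a"
  shows "bounded_linear f \<Longrightarrow> bounded_linear (f ^^ n)"
  by (induction n) (auto simp: id_def o_def bounded_linear_ident intro: bounded_linear_compose)

lemma norm_funpow_le:
  fixes f :: "'a::real_normed_vector \<Rightarrow> 'a"
  assumes "bounded_linear f"
  shows "norm ((f ^^ n) x) \<le> onorm f ^ n * norm x"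
proof (induction n)
  case (Suc n)
  have "norm ((f ^^ Suc n) x) \<le> onorm f * norm ((f ^^ n) x)"
    using onorm[OF assms] by simp
  also have "\<dots> \<le> onorm f * (onorm f ^ n * norm x)"
    by (intro mult_left_mono Suc onorm_pos_le assms)
  finally show ?case by simp
qed simp

lemma funpow_scaleC:
  "bounded_clinear T \<Longrightarrow> (T ^^ k) (c *\<^sub>C x) = c *\<^sub>C (T ^^ k) x"
  by (induction k) (auto simp: bounded_clinear_def)

text \<open>The number of multisets of size \<open>k\<close> over \<open>m\<close> elements, so that
  \<open>(1 - u)\<^sup>-\<^sup>m = (\<Sum>k. multichoose m k u\<^sup>k)\<close>; truncated subtraction gives the right value at \<open>m = 0\<close>.\<close>

definition multichoose :: "nat \<Rightarrow> nat \<Rightarrow> nat" where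
  "multichoose m k = (m + k - 1) choose k"

lemma multichoose_0_right [simp]: "multichoose m 0 = 1"
  by (simp add: multichoose_def)

lemma multichoose_0_left: "multichoose 0 k = (if k = 0 then 1 else 0)"
  by (cases k) (simp_all add: multichoose_def)

lemma multichoose_Suc_Suc: "multichoose (Suc m) (Suc k) = multichoose m (Suc k) + multichoose (Suc m) k"
  by (simp add: multichoose_def)

lemma multichoose_le: "multichoose m k \<le> 2 ^ (m + k)"
proof -
  have "multichoose m k \<le> 2 ^ (m + k - 1)"
    unfolding multichoose_def by (rule binomial_le_pow2)
  also have "\<dots> \<le> 2 ^ (m + k)" by (rule power_increasing) auto
  finally show ?thesis .
qed

lemma Suc_times_multichoose: "Suc k * multichoose m (Suc k) = m * multichoose (Suc m) k"
  using binomial_absorption[of k "m + k"] binomial_absorb_comp[of "m + k" k]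
  by (simp add: multichoose_def)

text \<open>The crude bound by powers of 2 limits the ratio to 1/2. This costs nothing, because
  \<open>n\<close> will be chosen so large that both \<open>q\<close> and \<open>q\<close> times the
  norm of \<open>T\<close> lie below 1/2.\<close>

lemma summable_multichoose:
  fixes r :: real
  assumes "0 \<le> r" "r < 1 / 2"
  shows "summable (\<lambda>k. real (multichoose m k) * r ^ k)"
proof (rule summable_comparison_test)
  have "real (multichoose m k) \<le> 2 ^ (m + k)" for k
    using multichoose_le[of m k] by (metis of_nat_le_iff of_nat_numeral of_nat_power)
  then have "norm (real (multichoose m k) * r ^ k) \<le> 2 ^ m * (2 * r) ^ k" for k
    using assms by (simp add: power_mult_distrib power_add mult_right_mono flip: mult.assoc)
  then show "\<exists>N. \<forall>k\<ge>N. norm (real (multichoose m k) * r ^ k) \<le> 2 ^ m * (2 * r) ^ k" by blast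
  show "summable (\<lambda>k. 2 ^ m * (2 * r) ^ k)"
    using assms by (intro summable_mult summable_geometric) auto
qed

text \<open>Pascal's rule makes \<open>1 - u\<close> lower the first parameter by one. The abstract
  sequence \<open>a\<close> serves two purposes: powers of a number \<open>q\<close>, and the
  vectors obtained by applying powers of \<open>q z T\<close> to a fixed \<open>y\<close>.\<close>

lemma multichoose_series:
  fixes u :: "'a::banach \<Rightarrow> 'a"
  assumes u: "bounded_linear u" and ua: "\<And>k. u (a k) = a (Suc k)"
    and a: "\<And>k. norm (a k) \<le> r ^ k * c" and r: "0 \<le> r" "r < 1 / 2"
  shows "summable (\<lambda>k. real (multichoose m k) *\<^sub>R a k)" (is ?sum)
    and "(\<Sum>k. real (multichoose (Suc m) k) *\<^sub>R a k) - u (\<Sum>k. real (multichoose (Suc m) k) *\<^sub>R a k) =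
      (\<Sum>k. real (multichoose m k) *\<^sub>R a k)" (is ?eq)
proof -
  have S: "summable (\<lambda>k. real (multichoose m k) *\<^sub>R a k)" for m
  proof (rule summable_comparison_test)
    show "\<exists>N. \<forall>k\<ge>N. norm (real (multichoose m k) *\<^sub>R a k) \<le> real (multichoose m k) * r ^ k * c"
      using a by (auto simp: mult.assoc intro!: mult_left_mono)
    show "summable (\<lambda>k. real (multichoose m k) * r ^ k * c)"
      by (intro summable_mult2 summable_multichoose r)
  qed
  then show ?sum .
  let ?G = "\<Sum>k. real (multichoose (Suc m) k) *\<^sub>R a k"
  have G: "(\<lambda>k. real (multichoose (Suc m) k) *\<^sub>R a k) sums ?G"
    by (rule summable_sums[OF S])
  then have 1: "(\<lambda>k. real (multichoose (Suc m) (Suc k)) *\<^sub>R a (Suc k)) sums (?G - a 0)"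
    by (subst sums_Suc_iff) simp
  have 2: "(\<lambda>k. real (multichoose (Suc m) k) *\<^sub>R a (Suc k)) sums u ?G"
    using bounded_linear.sums[OF u G]
    by (simp add: ua linear_cmul[OF bounded_linear.linear[OF u]])
  have "(\<lambda>k. real (multichoose m (Suc k)) *\<^sub>R a (Suc k)) sums (?G - a 0 - u ?G)"
    using sums_diff[OF 1 2] by (simp add: multichoose_Suc_Suc scaleR_left_distrib)
  then have "(\<lambda>k. real (multichoose m k) *\<^sub>R a k) sums (?G - u ?G)"
    by (subst (asm) sums_Suc_iff) simp
  then show ?eq by (simp add: sums_iff)
qed

lemma multichoose_sums:
  fixes q :: real
  assumes q: "0 \<le> q" "q < 1 / 2"
  shows "(\<lambda>k. real (multichoose m k) * q ^ k) sums (1 / (1 - q) ^ m)"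
proof -
  have s: "summable (\<lambda>k. real (multichoose m k) * q ^ k)" for m
    by (rule summable_multichoose[OF q])
  have "(\<Sum>k. real (multichoose m k) * q ^ k) = 1 / (1 - q) ^ m"
  proof (induction m)
    case 0
    show ?case
      using suminf_finite[of "{0::nat}" "\<lambda>k. real (multichoose 0 k) * q ^ k"]
      by (simp add: multichoose_0_left)
  next
    case (Suc m)
    have "(\<Sum>k. real (multichoose (Suc m) k) * q ^ k) * (1 - q) = (\<Sum>k. real (multichoose m k) * q ^ k)"
      using multichoose_series(2)[where u = "\<lambda>x. q * x" and a = "\<lambda>k. q ^ k" and r = q and c = 1 and m = m]
      using q bounded_linear_mult_right[of q] by (simp add: algebra_simps)
    then have "(\<Sum>k. real (multichoose (Suc m) k) * q ^ k) * (1 - q) = 1 / (1 - q) ^ m"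
      by (simp only: Suc)
    then show ?case using q by (simp add: eq_divide_eq mult.assoc)
  qed
  then show ?thesis using s[of m] by (simp add: sums_iff)
qed

text \<open>By absorption, a factor \<open>k\<close> is exchanged for a factor \<open>m\<close> and
  a larger first parameter, so the factorial moments reduce to series already summed. They yield the
  mean and the variance of the weights.\<close>

lemma multichoose_moment_sums:
  fixes q :: real
  assumes q: "0 \<le> q" "q < 1 / 2"
  shows "(\<lambda>k. real k * (real (multichoose m k) * q ^ k)) sums (m * q / (1 - q) ^ Suc m)"
    and "(\<lambda>k. real k * (real k - 1) * (real (multichoose m k) * q ^ k)) sums
      (real m * real (Suc m) * q\<^sup>2 / (1 - q) ^ (m + 2))"
proof -
  have e: "real (Suc k) * real (multichoose m (Suc k)) = real m * real (multichoose (Suc m) k)" for k m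
    using Suc_times_multichoose[of k m] by (metis of_nat_mult)
  have eq: "real (Suc k) * (real (multichoose m (Suc k)) * q ^ Suc k) =
      m * q * (real (multichoose (Suc m) k) * q ^ k)" for k m
  proof -
    have "real (Suc k) * (real (multichoose m (Suc k)) * q ^ Suc k) =
        real (Suc k) * real (multichoose m (Suc k)) * q ^ Suc k" by (simp only: mult.assoc)
    then show ?thesis unfolding e by (simp add: mult_ac)
  qed
  have "(\<lambda>k. m * q * (real (multichoose (Suc m) k) * q ^ k)) sums (m * q * (1 / (1 - q) ^ Suc m))" for m
    by (intro sums_mult multichoose_sums q)
  then have 1: "(\<lambda>k. real (Suc k) * (real (multichoose m (Suc k)) * q ^ Suc k)) sums
      (m * q / (1 - q) ^ Suc m)" for m
    unfolding eq by simp
  then have M: "(\<lambda>k. real k * (real (multichoose m k) * q ^ k)) sums (m * q / (1 - q) ^ Suc m)" for m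
    by (subst (asm) sums_Suc_iff) simp
  then show "(\<lambda>k. real k * (real (multichoose m k) * q ^ k)) sums (m * q / (1 - q) ^ Suc m)" .
  have eq2: "real (Suc k) * (real (Suc k) - 1) * (real (multichoose m (Suc k)) * q ^ Suc k) =
      m * q * (real k * (real (multichoose (Suc m) k) * q ^ k))" for k
  proof -
    have "real (Suc k) * (real (Suc k) - 1) * (real (multichoose m (Suc k)) * q ^ Suc k) =
        real k * (real (Suc k) * (real (multichoose m (Suc k)) * q ^ Suc k))" by simp
    then show ?thesis unfolding eq by (simp add: mult_ac)
  qed
  have "(\<lambda>k. m * q * (real k * (real (multichoose (Suc m) k) * q ^ k))) sums
      (m * q * (Suc m * q / (1 - q) ^ Suc (Suc m)))"
    by (intro sums_mult M)
  then have "(\<lambda>k. real (Suc k) * (real (Suc k) - 1) * (real (multichoose m (Suc k)) * q ^ Suc k)) sums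
      (real m * real (Suc m) * q\<^sup>2 / (1 - q) ^ (m + 2))"
    unfolding eq2 by (simp add: power2_eq_square mult_ac del: of_nat_Suc mult_Suc_right)
  then show "(\<lambda>k. real k * (real k - 1) * (real (multichoose m k) * q ^ k)) sums
      (real m * real (Suc m) * q\<^sup>2 / (1 - q) ^ (m + 2))"
    by (subst (asm) sums_Suc_iff) simp
qed

text \<open>With \<open>\<mu> = 1 / (q z)\<close> one has \<mu> - T = \<mu> (1 - q z T), and 1 - q z
  T maps the series \<open>g (Suc m)\<close> to \<open>g m\<close>. The resolvent therefore climbs
  from \<mu> times \<open>g m\<close> to \<open>g (Suc m)\<close>, and \<open>n\<close> applications
  to \<open>y = g 0\<close> give \<open>g n\<close> up to the factor \<mu>^n. Since |\<mu>| - 1 = (1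
  - q) / q, the powers of \<open>q\<close> cancel.\<close>

lemma resolvent_power_series_bound:
  fixes T :: "'a::complex_banach \<Rightarrow> 'a"
  assumes T: "bounded_clinear T" and K: "strongly_Kreiss_bounded K T"
    and q: "0 < q" "q < 1 / 2" and qT: "q * onorm T < 1 / 2" and z: "cmod z = 1" and n: "1 \<le> n"
  shows "summable (\<lambda>k. real (multichoose n k) *\<^sub>R q ^ k *\<^sub>R z ^ k *\<^sub>C (T ^^ k) y)"
    and "norm (\<Sum>k. real (multichoose n k) *\<^sub>R q ^ k *\<^sub>R z ^ k *\<^sub>C (T ^^ k) y) \<le> K / (1 - q) ^ n * norm y"
proof -
  have bl: "bounded_linear T" and Tc: "T (c *\<^sub>C x) = c *\<^sub>C T x" for c x
    using T by (auto simp: bounded_clinear_def)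
  define u where "u = (\<lambda>x. q *\<^sub>R z *\<^sub>C T x)"
  define a where "a k = q ^ k *\<^sub>R z ^ k *\<^sub>C (T ^^ k) y" for k
  define r where "r = q * onorm T"
  have r: "0 \<le> r" "r < 1 / 2" using q qT onorm_pos_le[OF bl] by (auto simp: r_def)
  have u: "bounded_linear u"
    unfolding u_def
    by (intro bounded_linear_compose[OF bounded_linear_scaleR_right]
        bounded_linear_compose[OF bounded_linear_scaleC_right] bl)
  have ua: "u (a k) = a (Suc k)" for k
    unfolding u_def a_def
    by (simp add: linear_cmul[OF bounded_linear.linear[OF bl]] Tc scaleC_scaleR scaleC_scaleC)
  have a: "norm (a k) \<le> r ^ k * norm y" for k
  proof -
    have "norm (a k) = q ^ k * norm ((T ^^ k) y)"
      using q z by (simp add: a_def norm_scaleC norm_power)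
    also have "\<dots> \<le> q ^ k * (onorm T ^ k * norm y)"
      using q by (intro mult_left_mono norm_funpow_le bl) auto
    finally show ?thesis by (simp add: r_def power_mult_distrib)
  qed
  note G = multichoose_series[OF u ua a r]
  define g where "g m = (\<Sum>k. real (multichoose m k) *\<^sub>R a k)" for m
  show "summable (\<lambda>k. real (multichoose n k) *\<^sub>R q ^ k *\<^sub>R z ^ k *\<^sub>C (T ^^ k) y)"
    using G(1)[of n] by (simp add: a_def)
  have g: "g (Suc m) - u (g (Suc m)) = g m" for m
    unfolding g_def by (rule G(2))
  have g0: "g 0 = y"
    unfolding g_def using suminf_finite[of "{0::nat}" "\<lambda>k. real (multichoose 0 k) *\<^sub>R a k"]
    by (simp add: multichoose_0_left a_def)
  define \<mu> where "\<mu> = 1 / (of_real q * z)"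
  have z0: "z \<noteq> 0" using z by auto
  have m0: "\<mu> \<noteq> 0" using z0 q by (simp add: \<mu>_def)
  have cm: "cmod \<mu> = 1 / q" using z q by (simp add: \<mu>_def norm_divide norm_mult)
  have m1: "cmod \<mu> > 1" using q cm by simp
  define R where "R = inv (shifted T \<mu>)"
  have bij: "bij (shifted T \<mu>)" and R: "bounded_clinear R"
    and Rn: "onorm (R ^^ n) \<le> K / (cmod \<mu> - 1) ^ n"
    using K m1 n unfolding strongly_Kreiss_bounded_def resolvent_set_def R_def by auto
  have sh: "shifted T \<mu> (g (Suc m)) = \<mu> *\<^sub>C g m" for m
  proof -
    have "u (g (Suc m)) = inverse \<mu> *\<^sub>C T (g (Suc m))"
      by (simp add: u_def \<mu>_def scaleC_scaleC flip: scaleC_of_real)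
    then have "\<mu> *\<^sub>C u (g (Suc m)) = T (g (Suc m))"
      using m0 by (simp add: scaleC_scaleC)
    then show ?thesis
      unfolding shifted_def
      by (simp add: linear_diff[OF bounded_linear.linear[OF bounded_linear_scaleC_right]]
          flip: g[of m])
  qed
  have Rg: "R (\<mu> *\<^sub>C g m) = g (Suc m)" for m
    unfolding R_def sh[symmetric] using bij by (simp add: bij_is_inj)
  have "(R ^^ m) y = (1 / \<mu>) ^ m *\<^sub>C g m" for m
  proof (induction m)
    case (Suc m)
    have "(R ^^ Suc m) y = R ((1 / \<mu>) ^ Suc m *\<^sub>C (\<mu> *\<^sub>C g m))"
      using Suc m0 by (simp add: scaleC_scaleC)
    also have "\<dots> = (1 / \<mu>) ^ Suc m *\<^sub>C R (\<mu> *\<^sub>C g m)"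
      using R unfolding bounded_clinear_def by blast
    finally show ?case by (simp only: Rg)
  qed (simp add: g0)
  then have "norm ((R ^^ n) y) = q ^ n * norm (g n)"
    using q cm by (simp add: norm_scaleC norm_power norm_divide power_divide)
  moreover have "norm ((R ^^ n) y) \<le> onorm (R ^^ n) * norm y"
    using R by (intro onorm bounded_linear_funpow) (simp add: bounded_clinear_def)
  moreover have "\<dots> \<le> K / (cmod \<mu> - 1) ^ n * norm y"
    by (intro mult_right_mono Rn) auto
  moreover have "K / (cmod \<mu> - 1) ^ n = q ^ n * (K / (1 - q) ^ n)"
  proof -
    have "cmod \<mu> - 1 = (1 - q) / q" using q cm by (simp add: field_simps)
    then show ?thesis by (simp add: power_divide)
  qed
  ultimately have "q ^ n * norm (g n) \<le> q ^ n * (K / (1 - q) ^ n * norm y)"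
    by (simp add: mult.assoc)
  then have "norm (g n) \<le> K / (1 - q) ^ n * norm y"
    by (rule mult_left_le_imp_le) (use q in simp)
  then show "norm (\<Sum>k. real (multichoose n k) *\<^sub>R q ^ k *\<^sub>R z ^ k *\<^sub>C (T ^^ k) y) \<le> K / (1 - q) ^ n * norm y"
    by (simp add: g_def a_def)
qed

text \<open>The weights are a truncated negative binomial distribution with mean \<open>N\<close> and variance at
  most \<open>2 N\<close>: up to the truncation, \<open>\<Sum>k. w k z\<^sup>k T\<^sup>k = (1 - q)\<^sup>n (1 - q z T)\<^sup>-\<^sup>n\<close> with
  \<open>q = N / (n + N)\<close>.  Letting \<open>n\<close> depend on \<open>T\<close> makes the series converge geometrically.\<close>

lemma concentrated_kernel:
  fixes T :: "'a::complex_banach \<Rightarrow> 'a"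
  assumes T: "bounded_clinear T" and K: "strongly_Kreiss_bounded K T"
    and N: "1 \<le> N" "N \<le> s\<^sup>2"
  obtains w :: "nat \<Rightarrow> real" and D :: nat where
    "\<And>k. 0 \<le> w k" "\<And>k. D \<le> k \<Longrightarrow> w k = 0" "\<And>A. finite A \<Longrightarrow> sum w A \<le> 1"
    "1 / 2 \<le> sum w {k. N < k + 3 * s \<and> k < N + 3 * s}"
    "\<And>z y. cmod z = 1 \<Longrightarrow> norm (\<Sum>k<D. w k *\<^sub>R z ^ k *\<^sub>C (T ^^ k) y) \<le> (K + 1) * norm y"
    "N = 1 \<Longrightarrow> exp (- 1) / 2 \<le> w 1"
proof -
  have bl: "bounded_linear T" using T by (auto simp: bounded_clinear_def)
  define \<tau> where "\<tau> = onorm T"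
  have \<tau>: "0 \<le> \<tau>" unfolding \<tau>_def by (rule onorm_pos_le[OF bl])
  \<comment> \<open>\<open>N < n\<close> gives \<open>q < 1 / 2\<close> and keeps the variance below
    \<open>2 N\<close>; \<open>2 N \<tau> < n\<close> gives \<open>q \<tau> < 1 / 2\<close>.\<close>
  define n where "n = nat \<lceil>2 * N * \<tau>\<rceil> + N + 1"
  have n: "N < n" "2 * N * \<tau> < n" "1 \<le> n"
    using N of_nat_ceiling[of "2 * N * \<tau>"] by (auto simp: n_def)
  define q where "q = N / (n + N)"
  have q: "0 < q" "q < 1 / 2" using N n by (auto simp: q_def field_simps)
  have q1: "1 - q = n / (n + N)" using N by (simp add: q_def field_simps)
  have qq: "q / (1 - q) = N / n" using N n by (simp add: q1) (simp add: q_def)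
  have qT: "q * \<tau> < 1 / 2"
  proof -
    have "2 * (N * \<tau>) < n + N" using n N by simp
    then show ?thesis using N by (simp add: q_def field_simps)
  qed
  define w0 where "w0 k = (1 - q) ^ n * (real (multichoose n k) * q ^ k)" for k
  have w0: "0 \<le> w0 k" for k using q by (simp add: w0_def)
  have s0: "w0 sums 1"
    using sums_mult[OF multichoose_sums[of q n], of "(1 - q) ^ n"] q by (simp add: w0_def[abs_def])
  have s1: "(\<lambda>k. real k * w0 k) sums N"
  proof -
    have "(\<lambda>k. (1 - q) ^ n * (real k * (real (multichoose n k) * q ^ k))) sums
       ((1 - q) ^ n * (n * q / (1 - q) ^ Suc n))"
      by (intro sums_mult multichoose_moment_sums) (use q in auto)
    moreover have "(1 - q) ^ n * (n * q / (1 - q) ^ Suc n) = n * (q / (1 - q))"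
      using q by simp
    ultimately show ?thesis using n by (simp add: w0_def mult_ac qq)
  qed
  have s2: "(\<lambda>k. real k * (real k - 1) * w0 k) sums ((real N)\<^sup>2 * real (Suc n) / n)"
  proof -
    have "(\<lambda>k. (1 - q) ^ n * (real k * (real k - 1) * (real (multichoose n k) * q ^ k))) sums
       ((1 - q) ^ n * (real n * real (Suc n) * q\<^sup>2 / (1 - q) ^ (n + 2)))"
      by (rule sums_mult[OF multichoose_moment_sums(2)]) (use q in auto)
    moreover have "(1 - q) ^ n * (real n * real (Suc n) * q\<^sup>2 / (1 - q) ^ (n + 2)) = real n * real (Suc n) * (q / (1 - q))\<^sup>2"
      using q by (simp add: power_add power_divide power2_eq_square)
    moreover have "real n * real (Suc n) * (N / n)\<^sup>2 = (real N)\<^sup>2 * real (Suc n) / n"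
      using n by (simp add: power2_eq_square divide_simps)
    ultimately show ?thesis by (simp add: w0_def mult_ac qq)
  qed
  have var: "(\<lambda>k. (real k - N)\<^sup>2 * w0 k) sums ((real N)\<^sup>2 / n + N)"
  proof -
    have "(\<lambda>k. real k * (real k - 1) * w0 k + (1 - 2 * real N) * (real k * w0 k) + (real N)\<^sup>2 * w0 k) sums
      ((real N)\<^sup>2 * Suc n / n + (1 - 2 * real N) * N + (real N)\<^sup>2 * 1)"
      by (intro sums_add sums_mult s0 s1 s2)
    moreover have "(real N)\<^sup>2 * Suc n / n + (1 - 2 * real N) * N + (real N)\<^sup>2 * 1 = (real N)\<^sup>2 / n + N"
      using n by (simp add: field_simps power2_eq_square)
    moreover have "real k * (real k - 1) * w0 k + (1 - 2 * real N) * (real k * w0 k) + (real N)\<^sup>2 * w0 k =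
        (real k - N)\<^sup>2 * w0 k" for k
      by (simp add: algebra_simps power2_eq_square)
    ultimately show ?thesis by simp
  qed
  define W where "W = {k. N < k + 3 * s \<and> k < N + 3 * s}"
  have finW: "finite W" by (rule finite_subset[of _ "{..<N + 3 * s}"]) (auto simp: W_def)
  have s: "0 < s" using N by (cases s) auto
  \<comment> \<open>Chebyshev's inequality: the variance is at most \<open>2 N\<close>, hence at
    most 2 s^2, so deviations of at least \<open>3 s\<close> carry a mass of at most 2/9.\<close>
  have W: "1 / 2 \<le> sum w0 W"
  proof -
    have "(\<lambda>k. w0 k - (if k \<in> W then w0 k else 0)) sums (1 - sum w0 W)"
      by (intro sums_diff s0 sums_If_finite_set finW)
    moreover have "(\<lambda>k. (1 / (9 * s\<^sup>2)) * ((real k - N)\<^sup>2 * w0 k)) sums ((1 / (9 * s\<^sup>2)) * ((real N)\<^sup>2 / n + N))"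
      by (intro sums_mult var)
    moreover have "w0 k - (if k \<in> W then w0 k else 0) \<le> (1 / (9 * s\<^sup>2)) * ((real k - N)\<^sup>2 * w0 k)" for k
    proof (cases "k \<in> W")
      case True
      then show ?thesis using w0[of k] by simp
    next
      case False
      then have "3 * real s \<le> \<bar>real k - N\<bar>" by (auto simp: W_def)
      then have "(3 * real s)\<^sup>2 \<le> (real k - N)\<^sup>2"
        by (metis abs_of_nat abs_le_square_iff abs_mult abs_numeral)
      then have "1 \<le> (1 / (9 * s\<^sup>2)) * (real k - N)\<^sup>2"
        using s by (simp add: field_simps)
      then show ?thesis using w0[of k] False mult_right_mono by fastforce
    qed
    ultimately have "1 - sum w0 W \<le> (1 / (9 * s\<^sup>2)) * ((real N)\<^sup>2 / n + N)"
      by (metis (no_types, lifting) sums_le)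
    also have "(real N)\<^sup>2 / n \<le> N"
      using n by (simp add: field_simps power2_eq_square mult_left_mono)
    then have "(1 / (9 * s\<^sup>2)) * ((real N)\<^sup>2 / n + N) \<le> (1 / (9 * s\<^sup>2)) * (2 * real (s\<^sup>2))"
      using N by (intro mult_left_mono) (auto simp flip: of_nat_power)
    also have "\<dots> = 2 / 9" using s by simp
    finally show ?thesis by simp
  qed
  have tail: "summable (\<lambda>k. real (multichoose n k) * (q * \<tau>) ^ k)"
    using q \<tau> qT by (intro summable_multichoose) auto
  from suminf_exist_split[OF zero_less_one tail] obtain D0 where
    D0: "\<And>D. D0 \<le> D \<Longrightarrow> norm (\<Sum>k. real (multichoose n (k + D)) * (q * \<tau>) ^ (k + D)) < 1"
    by blast
  \<comment> \<open>Beyond \<open>D0\<close> the tail of the operator series is at most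
    \<open>norm y\<close>, which turns \<open>K\<close> into \<open>K + 1\<close>; beyond
    \<open>N + 3 s\<close> no mass of the window is cut off.\<close>
  define D where "D = max D0 (N + 3 * s)"
  define w where "w k = (if k < D then w0 k else 0)" for k
  show ?thesis
  proof
    show "0 \<le> w k" for k using w0 by (simp add: w_def)
    show "w k = 0" if "D \<le> k" for k using that by (simp add: w_def)
    show "sum w A \<le> 1" if "finite A" for A
    proof -
      have "sum w A \<le> sum w0 A" by (intro sum_mono) (auto simp: w_def w0)
      also have "\<dots> \<le> suminf w0" using s0 w0 that by (intro sum_le_suminf) (auto simp: sums_iff)
      finally show ?thesis using s0 by (simp add: sums_iff)
    qed
    have "sum w W = sum w0 W" by (intro sum.cong) (auto simp: W_def w_def D_def)
    then show "1 / 2 \<le> sum w {k. N < k + 3 * s \<and> k < N + 3 * s}"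
      using W by (simp add: W_def)
    \<comment> \<open>The mass at 1 is (1 + 1/n)^(-n) times n / (n + 1), with (1 + 1/n)^n at most e
      and the second factor at least 1/2.\<close>
    show "exp (- 1) / 2 \<le> w 1" if "N = 1"
    proof -
      have "w 1 = (1 - q) ^ n * (n * q)"
        using that s by (simp add: w_def D_def w0_def multichoose_def)
      also have "\<dots> = (1 / (1 + 1 / n)) ^ n * (n / (n + 1))"
        using that n by (simp add: q1 q_def field_simps)
      also have "\<dots> \<ge> (1 / exp (1 / n)) ^ n * (1 / 2)"
      proof (intro mult_mono power_mono)
        show "1 / exp (1 / n) \<le> 1 / (1 + 1 / real n)"
          by (rule divide_left_mono) (auto intro!: mult_pos_pos add_pos_nonneg)
      qed (use n in \<open>auto simp: field_simps\<close>)
      also have "(1 / exp (1 / n)) ^ n * (1 / 2) = exp (- 1) / 2"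
        using n by (simp add: power_divide exp_minus inverse_eq_divide flip: exp_of_nat_mult)
      finally show ?thesis .
    qed
    fix z :: complex and y :: 'a
    assume z: "cmod z = 1"
    let ?t = "\<lambda>k. real (multichoose n k) *\<^sub>R q ^ k *\<^sub>R z ^ k *\<^sub>C (T ^^ k) y"
    note B = resolvent_power_series_bound[OF T K q qT[unfolded \<tau>_def] z n(3), of y]
    have "(\<Sum>k<D. w k *\<^sub>R z ^ k *\<^sub>C (T ^^ k) y) = (1 - q) ^ n *\<^sub>R (\<Sum>k<D. ?t k)"
      by (simp add: w_def w0_def scaleR_sum_right mult.assoc)
    also have "(\<Sum>k<D. ?t k) = suminf ?t - (\<Sum>k. ?t (k + D))"
      using suminf_split_initial_segment[OF B(1), of D] by simp
    finally have eq: "(\<Sum>k<D. w k *\<^sub>R z ^ k *\<^sub>C (T ^^ k) y) =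
        (1 - q) ^ n *\<^sub>R (suminf ?t - (\<Sum>k. ?t (k + D)))" .
    have tb: "norm (?t k) \<le> real (multichoose n k) * (q * \<tau>) ^ k * norm y" for k
    proof -
      have "norm (?t k) = real (multichoose n k) * q ^ k * norm ((T ^^ k) y)"
        using q z by (simp add: norm_scaleC norm_power)
      also have "\<dots> \<le> real (multichoose n k) * q ^ k * (\<tau> ^ k * norm y)"
        using q unfolding \<tau>_def by (intro mult_left_mono norm_funpow_le bl) auto
      finally show ?thesis by (simp add: power_mult_distrib mult_ac)
    qed
    have "norm (\<Sum>k. ?t (k + D)) \<le> (\<Sum>k. real (multichoose n (k + D)) * (q * \<tau>) ^ (k + D) * norm y)"
      by (rule norm_suminf_le[OF tb summable_mult2[OF summable_ignore_initial_segment[OF tail]]])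
    also have "\<dots> = (\<Sum>k. real (multichoose n (k + D)) * (q * \<tau>) ^ (k + D)) * norm y"
      by (rule suminf_mult2[symmetric]) (rule summable_ignore_initial_segment[OF tail])
    also have "\<dots> \<le> 1 * norm y"
      using D0[of D] by (intro mult_right_mono) (auto simp: D_def)
    finally have t: "norm (\<Sum>k. ?t (k + D)) \<le> norm y" by simp
    have "norm (suminf ?t - (\<Sum>k. ?t (k + D))) \<le> K / (1 - q) ^ n * norm y + norm y"
      using B(2) t by (intro order.trans[OF norm_triangle_ineq4]) auto
    then have "(1 - q) ^ n * norm (suminf ?t - (\<Sum>k. ?t (k + D))) \<le>
        (1 - q) ^ n * (K / (1 - q) ^ n * norm y + norm y)"
      using q by (intro mult_left_mono) auto
    also have "\<dots> = K * norm y + (1 - q) ^ n * norm y"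
      using q by (simp add: field_simps)
    also have "\<dots> \<le> K * norm y + 1 * norm y"
      using q by (intro add_left_mono mult_right_mono power_le_one) auto
    finally show "norm (\<Sum>k<D. w k *\<^sub>R z ^ k *\<^sub>C (T ^^ k) y) \<le> (K + 1) * norm y"
      unfolding eq norm_scaleR using q by (simp add: distrib_right)
  qed
qed

section \<open>Windows of orbits\<close>

lemma trig_sum_abel:
  fixes u :: "nat \<Rightarrow> real"
  shows "trig_sum {0..<n} (\<lambda>k. u k *\<^sub>R x k) t =
    u n *\<^sub>R trig_sum {0..<n} x t - (\<Sum>k<n. (u (Suc k) - u k) *\<^sub>R trig_sum {0..<Suc k} x t)"
  by (induction n) (simp_all add: trig_sum_def scaleC_scaleR algebra_simps)

text \<open>Multiplying by the kernel convolves the coefficients. On the right, for each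
  \<open>t\<close>, the kernel is evaluated at the unimodular number \<open>char_fun 1 t\<close> and
  acts on one vector, so its bound applies pointwise. \<open>M\<close> has to exceed all frequencies
  of the product.\<close>

lemma trig_sum_convolution:
  fixes T :: "'a::complex_banach \<Rightarrow> 'a"
  assumes T: "bounded_clinear T" and w: "\<And>k. D \<le> k \<Longrightarrow> w k = 0" and M: "D + J \<le> M"
  shows "trig_sum {0..<M} (\<lambda>l. \<Sum>k\<le>l. w k *\<^sub>R (T ^^ k) (if l - k < J then x (l - k) else 0)) t =
    (\<Sum>k<D. w k *\<^sub>R char_fun 1 t ^ k *\<^sub>C (T ^^ k) (trig_sum {0..<J} x t))"
proof -
  have bl: "bounded_linear (T ^^ k)" for k
    using T bounded_linear_funpow unfolding bounded_clinear_def by blast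
  note lin = bounded_linear.linear[OF bl]
  define e where "e = char_fun 1 t"
  define y where "y j = (if j < J then x j else 0)" for j
  define g where "g k j = w k *\<^sub>R e ^ (k + j) *\<^sub>C (T ^^ k) (y j)" for k j
  have "trig_sum {0..<M} (\<lambda>l. \<Sum>k\<le>l. w k *\<^sub>R (T ^^ k) (y (l - k))) t = (\<Sum>l<M. \<Sum>k\<le>l. g k (l - k))"
    unfolding trig_sum_def g_def char_fun_of_nat e_def atLeast0LessThan
    by (intro sum.cong refl) (simp add: scaleC_sum_right scaleC_scaleR)
  also have "\<dots> = (\<Sum>(k, j)\<in>{(k, j). k + j < M}. g k j)"
    by (rule sum.triangle_reindex[symmetric])
  also have "\<dots> = (\<Sum>(k, j)\<in>{..<D} \<times> {..<J}. g k j)"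
  proof (rule sum.mono_neutral_right)
    have "{(k, j). k + j < M} \<subseteq> {..<M} \<times> {..<M}" by auto
    then show "finite {(k, j). k + j < M}" by (rule finite_subset) auto
    show "{..<D} \<times> {..<J} \<subseteq> {(k, j). k + j < M}" using M by auto
    have "g k j = 0" if "\<not> (k < D \<and> j < J)" for k j
      using that w by (auto simp: g_def y_def linear_0[OF lin] not_less)
    then show "\<forall>i\<in>{(k, j). k + j < M} - {..<D} \<times> {..<J}. (case i of (k, j) \<Rightarrow> g k j) = 0"
      by auto
  qed
  also have "\<dots> = (\<Sum>k<D. \<Sum>j<J. g k j)"
    by (rule sum.cartesian_product[symmetric])
  also have "\<dots> = (\<Sum>k<D. w k *\<^sub>R e ^ k *\<^sub>C (T ^^ k) (trig_sum {0..<J} x t))"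
    unfolding trig_sum_def char_fun_of_nat atLeast0LessThan
    by (intro sum.cong refl)
      (simp add: linear_sum[OF lin] g_def y_def scaleC_sum_right scaleR_sum_right
        funpow_scaleC[OF T] scaleC_scaleC power_add e_def)
  finally show ?thesis by (simp add: y_def e_def)
qed

text \<open>The norms of the orbit polynomial \<open>x \<mapsto> \<Sum>k<n. e\<^sub>k T\<^sup>k x\<close> and of the map
  \<open>\<Sum>k<n. e\<^sub>k c\<^sub>k \<mapsto> \<Sum>k<n. T\<^sup>n\<^sup>-\<^sup>1\<^sup>-\<^sup>k c\<^sub>k\<close>; the latter replaces the orbit polynomial of the adjoint, so that
  no duality is needed.\<close>

definition orbit_bound :: "real \<Rightarrow> ('a::complex_banach \<Rightarrow> 'a) \<Rightarrow> nat \<Rightarrow> real \<Rightarrow> bool" where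
  "orbit_bound p T n b \<longleftrightarrow> (\<forall>x. Lp_norm p (trig_sum {0..<n} (\<lambda>k. (T ^^ k) x)) \<le> b * norm x)"

definition coorbit_bound :: "real \<Rightarrow> ('a::complex_banach \<Rightarrow> 'a) \<Rightarrow> nat \<Rightarrow> real \<Rightarrow> bool" where
  "coorbit_bound p T n b \<longleftrightarrow>
    (\<forall>c. norm (\<Sum>k<n. (T ^^ (n - 1 - k)) (c k)) \<le> b * Lp_norm p (trig_sum {0..<n} c))"

text \<open>Padding \<open>c\<close> with zeros on both sides gives a polynomial of length
  \<open>n\<close> that differs from the given one by a translation of frequencies only, so no
  constant is lost.\<close>

lemma coorbit_bound_sub:
  assumes T: "bounded_clinear T" and p: "0 < p" and b: "coorbit_bound p T n b" and dn: "d + m \<le> n"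
  shows "norm (\<Sum>k<m. (T ^^ (n - 1 - (d + k))) (c k)) \<le> b * Lp_norm p (trig_sum {0..<m} c)"
proof -
  have lin: "linear (T ^^ k)" for k
    using T bounded_linear_funpow bounded_linear.linear unfolding bounded_clinear_def by blast
  define c' where "c' k = (if d \<le> k \<and> k < d + m then c (k - d) else 0)" for k
  have "(\<Sum>k<n. (T ^^ (n - 1 - k)) (c' k)) = (\<Sum>k\<in>{0 + d..<m + d}. (T ^^ (n - 1 - k)) (c (k - d)))"
    using dn by (intro sum.mono_neutral_cong_right) (auto simp: c'_def linear_0[OF lin])
  also have "\<dots> = (\<Sum>k<m. (T ^^ (n - 1 - (d + k))) (c k))"
    by (subst sum.shift_bounds_nat_ivl) (simp add: atLeast0LessThan add.commute)
  finally have 1: "(\<Sum>k<n. (T ^^ (n - 1 - k)) (c' k)) = (\<Sum>k<m. (T ^^ (n - 1 - (d + k))) (c k))" .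
  have "trig_sum {0..<n} c' = trig_sum {0 + d..<m + d} c'"
    unfolding trig_sum_def using dn by (intro ext sum.mono_neutral_cong_right) (auto simp: c'_def)
  then have "Lp_norm p (trig_sum {0..<n} c') = Lp_norm p (trig_sum {0..<m} (\<lambda>k. c' (k + d)))"
    by (simp only: Lp_norm_trig_sum_shift[OF p])
  also have "trig_sum {0..<m} (\<lambda>k. c' (k + d)) = trig_sum {0..<m} c"
    by (rule trig_sum_cong) (simp add: c'_def)
  finally show ?thesis
    using b 1 unfolding coorbit_bound_def by metis
qed

text \<open>Conditions (1) and (2) in the form used by the recursion: interval projections, and
  families of equal blocks. A uniform bound for the blocks turns the sum of q0-th powers into
  \<open>m powr (1 / q0)\<close>, so \<open>a0\<close> stands for \<open>\<gamma>0 + 1 / q0\<close>;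
  the power mean inequality makes \<open>a1\<close> stand for
  \<open>\<gamma>1 + (1 - 1 / q1)\<close>.\<close>

locale interval_estimates =
  fixes ty :: "'a::complex_banach itself" and p R U L a0 a1 :: real
  assumes p: "1 \<le> p" and R: "1 \<le> R" and UL: "0 < U" "0 < L" and a01: "0 \<le> a0" "0 \<le> a1"
    and riesz: "\<And>a b M (x :: nat \<Rightarrow> 'a). b \<le> M \<Longrightarrow>
      Lp_norm p (trig_sum {a..<b} x) \<le> R * Lp_norm p (trig_sum {0..<M} x)"
    and upper: "\<And>m l (x :: nat \<Rightarrow> 'a) B. 1 \<le> l \<Longrightarrow> 0 \<le> B \<Longrightarrow>
      (\<And>i. i < m \<Longrightarrow> Lp_norm p (trig_sum {i * l..<i * l + l} x) \<le> B) \<Longrightarrow>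
      Lp_norm p (trig_sum {0..<m * l} x) \<le> U * real m powr a0 * B"
    and lower: "\<And>m l (x :: nat \<Rightarrow> 'a). 1 \<le> l \<Longrightarrow>
      (\<Sum>i<m. Lp_norm p (trig_sum {i * l..<i * l + l} x)) \<le>
        L * real m powr a1 * Lp_norm p (trig_sum {0..<m * l} x)"
begin

section \<open>Multipliers of bounded variation and a uniform bound for the operator\<close>

lemma p_pos: "0 < p" using p by simp

text \<open>Summation by parts leaves partial sums, which are projections to intervals and cost a
  factor \<open>R\<close> each; their coefficients add up to the variation of
  \<open>u\<close>.\<close>

lemma multiplier_bound:
  fixes x :: "nat \<Rightarrow> 'a" and u :: "nat \<Rightarrow> real"
  assumes "\<bar>u n\<bar> \<le> c" "(\<Sum>k<n. \<bar>u (Suc k) - u k\<bar>) \<le> V"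
  shows "Lp_norm p (trig_sum {0..<n} (\<lambda>k. u k *\<^sub>R x k)) \<le> R * (c + V) * Lp_norm p (trig_sum {0..<n} x)"
proof -
  let ?N = "Lp_norm p (trig_sum {0..<n} x)"
  have "trig_sum {0..<n} (\<lambda>k. u k *\<^sub>R x k) = (\<lambda>t. u n *\<^sub>R trig_sum {0..<n} x t +
     (\<Sum>k<n. (- (u (Suc k) - u k)) *\<^sub>R trig_sum {0..<Suc k} x t))"
    unfolding trig_sum_abel by (simp only: scaleR_minus_left sum_negf add_uminus_conv_diff)
  then have "Lp_norm p (trig_sum {0..<n} (\<lambda>k. u k *\<^sub>R x k)) \<le>
      Lp_norm p (\<lambda>t. u n *\<^sub>R trig_sum {0..<n} x t) +
      Lp_norm p (\<lambda>t. \<Sum>k<n. (- (u (Suc k) - u k)) *\<^sub>R trig_sum {0..<Suc k} x t)"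
    by (simp only:) (intro Lp_norm_triangle p continuous_intros)
  also have "Lp_norm p (\<lambda>t. \<Sum>k<n. (- (u (Suc k) - u k)) *\<^sub>R trig_sum {0..<Suc k} x t) \<le>
     (\<Sum>k<n. Lp_norm p (\<lambda>t. (- (u (Suc k) - u k)) *\<^sub>R trig_sum {0..<Suc k} x t))"
    by (intro Lp_norm_sum p continuous_intros) auto
  also have "\<dots> \<le> (\<Sum>k<n. \<bar>u (Suc k) - u k\<bar> * (R * ?N))"
  proof (rule sum_mono)
    fix k assume k: "k \<in> {..<n}"
    have "Lp_norm p (\<lambda>t. (- (u (Suc k) - u k)) *\<^sub>R trig_sum {0..<Suc k} x t) \<le>
        \<bar>- (u (Suc k) - u k)\<bar> * Lp_norm p (trig_sum {0..<Suc k} x)"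
      by (intro Lp_norm_scaleR p_pos continuous_intros)
    also have "\<dots> \<le> \<bar>- (u (Suc k) - u k)\<bar> * (R * ?N)"
      using k by (intro mult_left_mono riesz) auto
    finally show "Lp_norm p (\<lambda>t. (- (u (Suc k) - u k)) *\<^sub>R trig_sum {0..<Suc k} x t) \<le>
        \<bar>u (Suc k) - u k\<bar> * (R * ?N)" by (simp only: abs_minus_cancel)
  qed
  also have "\<dots> = (\<Sum>k<n. \<bar>u (Suc k) - u k\<bar>) * (R * ?N)"
    by (simp add: sum_distrib_right)
  also have "\<dots> \<le> V * (R * ?N)"
    using assms R by (intro mult_right_mono) auto
  also have "Lp_norm p (\<lambda>t. u n *\<^sub>R trig_sum {0..<n} x t) \<le> \<bar>u n\<bar> * ?N"
    by (intro Lp_norm_scaleR p_pos continuous_intros)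
  also have "\<dots> \<le> c * (R * ?N)"
    using mult_right_mono[OF R, of ?N] assms(1) by (intro mult_mono) auto
  finally show ?thesis by (simp add: algebra_simps)
qed

text \<open>The mass of a sliding window is a difference of two monotone functions with values in
  [0, 1], hence the form \<open>F k - G k\<close>. Its variation is at most 2, inversion multiplies
  this by at most 4, and the end value is at most 2: 8 + 2 = 10. The bound at \<open>k = n\<close>
  is required because summation by parts evaluates the multiplier there.\<close>

lemma inverse_multiplier_bound:
  fixes x :: "nat \<Rightarrow> 'a" and F G :: "nat \<Rightarrow> real"
  assumes v: "\<And>k. k \<le> n \<Longrightarrow> 1 / 2 \<le> F k - G k"
    and F: "(\<Sum>k<n. \<bar>F (Suc k) - F k\<bar>) \<le> 1" and G: "(\<Sum>k<n. \<bar>G (Suc k) - G k\<bar>) \<le> 1"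
  shows "Lp_norm p (trig_sum {0..<n} (\<lambda>k. (1 / (F k - G k)) *\<^sub>R x k)) \<le>
    10 * R * Lp_norm p (trig_sum {0..<n} x)"
proof -
  define v where "v k = F k - G k" for k
  have v: "1 / 2 \<le> v k" if "k \<le> n" for k using assms(1)[OF that] by (simp add: v_def)
  have "(\<Sum>k<n. \<bar>1 / v (Suc k) - 1 / v k\<bar>) \<le> (\<Sum>k<n. 4 * (\<bar>F (Suc k) - F k\<bar> + \<bar>G (Suc k) - G k\<bar>))"
  proof (rule sum_mono)
    fix k assume "k \<in> {..<n}"
    then have vv: "1 / 2 \<le> v (Suc k)" "1 / 2 \<le> v k" using v by auto
    have "1 / v (Suc k) - 1 / v k = (v k - v (Suc k)) * (1 / (v (Suc k) * v k))"
      using vv by (simp add: divide_simps)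
    then have "\<bar>1 / v (Suc k) - 1 / v k\<bar> = \<bar>v k - v (Suc k)\<bar> * (1 / (v (Suc k) * v k))"
      using vv by (simp add: abs_mult)
    also have "\<dots> \<le> \<bar>v k - v (Suc k)\<bar> * (1 / (1 / 2 * (1 / 2)))"
      using vv by (intro mult_left_mono divide_left_mono mult_mono mult_pos_pos) auto
    also have "\<bar>v k - v (Suc k)\<bar> \<le> \<bar>F (Suc k) - F k\<bar> + \<bar>G (Suc k) - G k\<bar>"
      unfolding v_def by linarith
    then have "\<bar>v k - v (Suc k)\<bar> * (1 / (1 / 2 * (1 / 2))) \<le> 4 * (\<bar>F (Suc k) - F k\<bar> + \<bar>G (Suc k) - G k\<bar>)"
      by simp
    finally show "\<bar>1 / v (Suc k) - 1 / v k\<bar> \<le> 4 * (\<bar>F (Suc k) - F k\<bar> + \<bar>G (Suc k) - G k\<bar>)" .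
  qed
  also have "\<dots> \<le> 8"
    using F G unfolding sum_distrib_left[symmetric] sum.distrib by simp
  finally have V: "(\<Sum>k<n. \<bar>1 / v (Suc k) - 1 / v k\<bar>) \<le> 8" .
  have "\<bar>1 / v n\<bar> \<le> 2" using v[of n] by (simp add: field_simps)
  from multiplier_bound[OF this V, of x] show ?thesis by (simp add: v_def mult_ac)
qed

lemma convolution_bound:
  fixes T :: "'a \<Rightarrow> 'a"
  assumes T: "bounded_clinear T" and w: "\<And>k. D \<le> k \<Longrightarrow> w k = 0" and M: "D + J \<le> M" and C: "0 \<le> C"
    and wC: "\<And>z y. cmod z = 1 \<Longrightarrow> norm (\<Sum>k<D. w k *\<^sub>R z ^ k *\<^sub>C (T ^^ k) y) \<le> C * norm y"
  shows "Lp_norm p (trig_sum {0..<M} (\<lambda>l. \<Sum>k\<le>l. w k *\<^sub>R (T ^^ k) (if l - k < J then x (l - k) else 0))) \<le>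
    C * Lp_norm p (trig_sum {0..<J} x)"
proof (intro Lp_norm_mono p_pos continuous_intros C)
  show "norm (trig_sum {0..<M} (\<lambda>l. \<Sum>k\<le>l. w k *\<^sub>R (T ^^ k) (if l - k < J then x (l - k) else 0)) t) \<le>
      C * norm (trig_sum {0..<J} x t)" for t
    by (subst trig_sum_convolution[OF T _ M]) (use w in \<open>auto intro!: wC\<close>)
qed

text \<open>One frequency is an interval, and a polynomial with one frequency has constant
  norm.\<close>

lemma norm_coeff_le:
  fixes x :: "nat \<Rightarrow> 'a"
  assumes "k < M"
  shows "norm (x k) \<le> R * Lp_norm p (trig_sum {0..<M} x)"
proof -
  have "norm (trig_sum {k..<Suc k} x t) = norm (x k)" for t
    by (simp add: trig_sum_def norm_scaleC)
  from Lp_norm_const[OF p_pos this]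
  have "norm (x k) = Lp_norm p (trig_sum {k..<Suc k} x)" by simp
  then show ?thesis using riesz[of "Suc k" M k x] assms by simp
qed

text \<open>The kernel with \<open>N = 1\<close>, applied to the constant polynomial
  \<open>x\<close>, has the coefficient \<open>w 1\<close> times \<open>T x\<close> at frequency 1,
  and \<open>w 1\<close> is bounded below independently of \<open>T\<close>. This makes the bounds
  for short lengths uniform.\<close>

lemma norm_operator_le:
  fixes T :: "'a \<Rightarrow> 'a"
  assumes T: "bounded_clinear T" and K: "strongly_Kreiss_bounded K T" "0 \<le> K"
  shows "norm (T x) \<le> 2 * exp 1 * R * (K + 1) * norm x"
proof -
  have lin: "linear (T ^^ k)" for k
    using T bounded_linear_funpow bounded_linear.linear unfolding bounded_clinear_def by blast
  obtain w D where w: "\<And>k. D \<le> k \<Longrightarrow> w k = 0"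
    and wK: "\<And>z y. cmod z = 1 \<Longrightarrow> norm (\<Sum>k<D. w k *\<^sub>R z ^ k *\<^sub>C (T ^^ k) y) \<le> (K + 1) * norm y"
    and w1: "exp (- 1) / 2 \<le> w 1"
    by (rule concentrated_kernel[OF T K(1), of 1 1]) (simp, simp, blast)
  let ?h = "\<lambda>l. \<Sum>k\<le>l. w k *\<^sub>R (T ^^ k) (if l - k < 1 then x else 0)"
  have "?h 1 = w 1 *\<^sub>R T x" by (simp add: linear_0[OF lin, of 0, simplified])
  moreover have "norm (?h 1) \<le> R * Lp_norm p (trig_sum {0..<D + 2} ?h)"
    by (rule norm_coeff_le) simp
  ultimately have "w 1 * norm (T x) \<le> R * Lp_norm p (trig_sum {0..<D + 2} ?h)"
    using w1 order_trans[of 0 "exp (- 1) / 2" "w 1"] by simp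
  also have "\<dots> \<le> R * ((K + 1) * Lp_norm p (trig_sum {0..<1} (\<lambda>k. x)))"
    using R K by (intro mult_left_mono convolution_bound[OF T w _ _ wK]) auto
  also have "Lp_norm p (trig_sum {0..<1} (\<lambda>k. x)) = norm x"
    by (rule Lp_norm_const[OF p_pos]) (simp add: trig_sum_def norm_scaleC)
  finally have "exp (- 1) / 2 * norm (T x) \<le> R * ((K + 1) * norm x)"
    using mult_right_mono[OF w1, of "norm (T x)"] by simp
  then have "2 * exp 1 * (exp (- 1) / 2 * norm (T x)) \<le> 2 * exp 1 * (R * ((K + 1) * norm x))"
    by (intro mult_left_mono) auto
  also have "2 * exp 1 * (exp (- 1) / 2 * norm (T x)) = norm (T x)"
    by (simp add: exp_minus)
  finally show ?thesis by (simp add: mult_ac)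
qed

end

lemma sum_diff_abs_mono:
  fixes f :: "nat \<Rightarrow> real"
  assumes "mono f \<or> antimono f" "\<And>k. 0 \<le> f k" "\<And>k. f k \<le> 1"
  shows "(\<Sum>k<n. \<bar>f (Suc k) - f k\<bar>) \<le> 1"
proof -
  have "(\<Sum>k<n. \<bar>f (Suc k) - f k\<bar>) = \<bar>f n - f 0\<bar>"
    using assms(1)
  proof
    assume m: "mono f"
    then have "(\<Sum>k<n. \<bar>f (Suc k) - f k\<bar>) = (\<Sum>k<n. f (Suc k) - f k)"
      by (intro sum.cong) (simp_all add: incseq_SucD)
    then show ?thesis using monoD[OF m, of 0 n] by (simp add: sum_lessThan_telescope)
  next
    assume m: "antimono f"
    then have "(\<Sum>k<n. \<bar>f (Suc k) - f k\<bar>) = (\<Sum>k<n. f k - f (Suc k))"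
      by (intro sum.cong refl) (simp add: abs_of_nonpos decseq_SucD)
    then show ?thesis using antimonoD[OF m, of 0 n] by (simp add: sum_lessThan_telescope')
  qed
  also have "\<dots> \<le> 1" using assms(2)[of 0] assms(2)[of n] assms(3)[of 0] assms(3)[of n] by linarith
  finally show ?thesis .
qed

section \<open>Transport of windows of length \<open>3 s\<close> by the kernel\<close>

context interval_estimates
begin

lemma one_le_window_const: "0 \<le> K \<Longrightarrow> 1 \<le> 10 * R\<^sup>2 * (K + 1)"
  using one_le_power[OF R, of 2] mult_mono[of 1 "R\<^sup>2" 1 "K + 1"] by simp

text \<open>The kernel times the orbit polynomial of length \<open>9 s\<close> has at frequency
  \<open>l\<close> the coefficient \<open>v l\<close> times the l-th orbit vector, where
  \<open>v l\<close> is the mass of the \<open>9 s\<close> indices up to \<open>l\<close>. The bulk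
  of the mass occupies about \<open>6 s\<close> indices around \<open>N\<close>; the remaining
  \<open>3 s\<close> leave room for \<open>l\<close> to vary over the window while
  \<open>v l\<close> stays above 1/2. Dividing by \<open>v\<close> is then a multiplier of bounded
  variation.\<close>

lemma orbit_window:
  fixes T :: "'a \<Rightarrow> 'a"
  assumes T: "bounded_clinear T" and K: "strongly_Kreiss_bounded K T" "0 \<le> K"
    and b: "orbit_bound p T (9 * s) b" "0 \<le> b" and N: "N \<le> s\<^sup>2"
  shows "Lp_norm p (trig_sum {0..<3 * s} (\<lambda>k. (T ^^ (k + (N + 3 * s))) x)) \<le>
    10 * R\<^sup>2 * (K + 1) * b * norm x"
proof (cases "N = 0")
  \<comment> \<open>The kernel has a positive mean; for \<open>N = 0\<close> the window already lies
    inside the orbit of length \<open>9 s\<close>.\<close>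
  case True
  have "Lp_norm p (trig_sum {0..<3 * s} (\<lambda>k. (T ^^ (k + (N + 3 * s))) x)) =
      Lp_norm p (trig_sum {0 + 3 * s..<3 * s + 3 * s} (\<lambda>k. (T ^^ k) x))"
    using True Lp_norm_trig_sum_shift[OF p_pos, of 0 "3 * s" "3 * s" "\<lambda>k. (T ^^ k) x"] by simp
  also have "\<dots> \<le> R * Lp_norm p (trig_sum {0..<9 * s} (\<lambda>k. (T ^^ k) x))"
    by (rule riesz) simp
  also have "\<dots> \<le> R * (b * norm x)"
    using b R unfolding orbit_bound_def by (intro mult_left_mono) auto
  also have "\<dots> \<le> (10 * R * (K + 1)) * (R * (b * norm x))"
    using b R K mult_mono[of 1 R 1 "K + 1"] mult_right_mono[of 1 "10 * R * (K + 1)" "R * (b * norm x)"]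
    by simp
  finally show ?thesis by (simp add: power2_eq_square mult_ac)
next
  case False
  then have N1: "1 \<le> N" by simp
  have lin: "linear (T ^^ k)" for k
    using T bounded_linear_funpow bounded_linear.linear unfolding bounded_clinear_def by blast
  obtain w D where w: "\<And>k. 0 \<le> w k" "\<And>k. D \<le> k \<Longrightarrow> w k = 0"
    and w1: "\<And>A. finite A \<Longrightarrow> sum w A \<le> 1"
    and w2: "1 / 2 \<le> sum w {k. N < k + 3 * s \<and> k < N + 3 * s}"
    and wK: "\<And>z y. cmod z = 1 \<Longrightarrow> norm (\<Sum>k<D. w k *\<^sub>R z ^ k *\<^sub>C (T ^^ k) y) \<le> (K + 1) * norm y"
    by (rule concentrated_kernel[OF T K(1) N1 N]) blast
  define W where "W n = sum w {..<n}" for n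
  have W: "mono W" "0 \<le> W n" "W n \<le> 1" for n
    unfolding W_def using w w1 by (auto intro!: monoI sum_mono2 sum_nonneg)
  \<comment> \<open>For small \<open>l\<close> the truncated subtraction gives
    \<open>W 0 = 0\<close>, as it should: there is no mass at negative indices.\<close>
  define v where "v l = W (Suc l) - W (Suc l - 9 * s)" for l
  have v_eq: "v l = sum w {Suc l - 9 * s..<Suc l}" for l
    using sum_diff_nat_ivl[of 0 "Suc l - 9 * s" "Suc l" w] by (simp add: v_def W_def atLeast0LessThan)
  let ?h = "\<lambda>l. \<Sum>k\<le>l. w k *\<^sub>R (T ^^ k) (if l - k < 9 * s then (T ^^ (l - k)) x else 0)"
  have h: "?h l = v l *\<^sub>R (T ^^ l) x" for l
  proof -
    have "?h l = (\<Sum>k\<in>{Suc l - 9 * s..<Suc l}. w k *\<^sub>R (T ^^ l) x)"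
    proof (rule sum.mono_neutral_cong_right)
      show "w k *\<^sub>R (T ^^ k) (if l - k < 9 * s then (T ^^ (l - k)) x else 0) = w k *\<^sub>R (T ^^ l) x"
        if "k \<in> {Suc l - 9 * s..<Suc l}" for k
      proof -
        have "(T ^^ k) ((T ^^ (l - k)) x) = (T ^^ (k + (l - k))) x" by (simp only: funpow_add o_apply)
        then show ?thesis using that by auto
      qed
    qed (auto simp: linear_0[OF lin])
    then show ?thesis by (simp only: v_eq scaleR_sum_left)
  qed
  let ?c = "N + 3 * s"
  have "Lp_norm p (trig_sum {0 + ?c..<3 * s + ?c} ?h) \<le> R * Lp_norm p (trig_sum {0..<D + 9 * s + N} ?h)"
    by (rule riesz) simp
  also have "\<dots> \<le> R * ((K + 1) * Lp_norm p (trig_sum {0..<9 * s} (\<lambda>k. (T ^^ k) x)))"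
    using R K by (intro mult_left_mono convolution_bound[OF T w(2) _ _ wK]) auto
  also have "\<dots> \<le> R * ((K + 1) * (b * norm x))"
    using R K b by (intro mult_left_mono) (auto simp: orbit_bound_def)
  finally have 1: "Lp_norm p (trig_sum {0..<3 * s} (\<lambda>k. v (k + ?c) *\<^sub>R (T ^^ (k + ?c)) x)) \<le> R * ((K + 1) * (b * norm x))"
    unfolding Lp_norm_trig_sum_shift[OF p_pos] h .
  have vhalf: "1 / 2 \<le> v (k + ?c)" if "k \<le> 3 * s" for k
  proof -
    have "{k. N < k + 3 * s \<and> k < N + 3 * s} \<subseteq> {Suc (k + ?c) - 9 * s..<Suc (k + ?c)}"
      using that by auto
    then have "sum w {k. N < k + 3 * s \<and> k < N + 3 * s} \<le> v (k + ?c)"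
      unfolding v_eq using w by (intro sum_mono2) auto
    then show ?thesis using w2 by simp
  qed
  have "Lp_norm p (trig_sum {0..<3 * s} (\<lambda>k. (1 / (W (Suc (k + ?c)) - W (Suc (k + ?c) - 9 * s))) *\<^sub>R
      (v (k + ?c) *\<^sub>R (T ^^ (k + ?c)) x))) \<le>
      10 * R * Lp_norm p (trig_sum {0..<3 * s} (\<lambda>k. v (k + ?c) *\<^sub>R (T ^^ (k + ?c)) x))"
  proof (rule inverse_multiplier_bound)
    show "(\<Sum>k<3 * s. \<bar>W (Suc (Suc k + ?c)) - W (Suc (k + ?c))\<bar>) \<le> 1"
      by (rule sum_diff_abs_mono[of "\<lambda>k. W (Suc (k + ?c))"])
        (auto simp: W(2,3) intro!: monoI monoD[OF W(1)])
    show "(\<Sum>k<3 * s. \<bar>W (Suc (Suc k + ?c) - 9 * s) - W (Suc (k + ?c) - 9 * s)\<bar>) \<le> 1"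
      by (rule sum_diff_abs_mono[of "\<lambda>k. W (Suc (k + ?c) - 9 * s)"])
        (auto simp: W(2,3) intro!: monoI monoD[OF W(1)])
  qed (use vhalf in \<open>simp add: v_def\<close>)
  also have "trig_sum {0..<3 * s} (\<lambda>k. (1 / (W (Suc (k + ?c)) - W (Suc (k + ?c) - 9 * s))) *\<^sub>R
      (v (k + ?c) *\<^sub>R (T ^^ (k + ?c)) x)) = trig_sum {0..<3 * s} (\<lambda>k. (T ^^ (k + ?c)) x)"
  proof (rule trig_sum_cong)
    fix k assume "k \<in> {0..<3 * s}"
    then have "v (k + ?c) \<noteq> 0" using vhalf[of k] by auto
    then show "(1 / (W (Suc (k + ?c)) - W (Suc (k + ?c) - 9 * s))) *\<^sub>R (v (k + ?c) *\<^sub>R (T ^^ (k + ?c)) x) =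
        (T ^^ (k + ?c)) x"
      unfolding v_def[symmetric] by simp
  qed
  also have "10 * R * Lp_norm p (trig_sum {0..<3 * s} (\<lambda>k. v (k + ?c) *\<^sub>R (T ^^ (k + ?c)) x)) \<le>
      10 * R * (R * ((K + 1) * (b * norm x)))"
    using R by (intro mult_left_mono 1) auto
  finally show ?thesis by (simp add: power2_eq_square mult_ac)
qed

text \<open>Here the weights are divided out of the input before the kernel is applied. The
  coefficients of the product at the \<open>9 s\<close> frequencies from \<open>a\<close> on are fed
  to the short coorbit map. Kernel power and coorbit power add up to an exponent that depends on
  \<open>j\<close> only, so the contributions of \<open>y j\<close> sum to the mass
  \<open>v j\<close>.\<close>

lemma coorbit_window:
  fixes T :: "'a \<Rightarrow> 'a"
  assumes T: "bounded_clinear T" and K: "strongly_Kreiss_bounded K T" "0 \<le> K"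
    and b: "coorbit_bound p T (9 * s) b" "0 \<le> b" and N: "N \<le> s\<^sup>2"
  shows "norm (\<Sum>k<3 * s. (T ^^ (N + 6 * s - 1 - k)) (x k)) \<le>
    10 * R\<^sup>2 * (K + 1) * b * Lp_norm p (trig_sum {0..<3 * s} x)"
proof (cases "N < 3 * s")
  \<comment> \<open>Here \<open>N - 3 s\<close> would be negative, but all exponents stay below
    \<open>9 s\<close> and the short coorbit bound applies directly.\<close>
  case True
  have "(\<Sum>k<3 * s. (T ^^ (N + 6 * s - 1 - k)) (x k)) =
      (\<Sum>k<3 * s. (T ^^ (9 * s - 1 - ((3 * s - N) + k))) (x k))"
    using True by (intro sum.cong refl) (simp add: algebra_simps)
  also have "norm \<dots> \<le> b * Lp_norm p (trig_sum {0..<3 * s} x)"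
    by (rule coorbit_bound_sub[OF T p_pos b(1)]) simp
  also have "\<dots> \<le> (10 * R\<^sup>2 * (K + 1)) * (b * Lp_norm p (trig_sum {0..<3 * s} x))"
    using b K mult_right_mono[OF one_le_window_const, of K "b * Lp_norm p (trig_sum {0..<3 * s} x)"]
    by simp
  finally show ?thesis by (simp add: mult_ac)
next
  case False
  show ?thesis
  proof (cases "s = 0")
    case True
    then show ?thesis using b R K by simp
  next
    case s: False
    have N1: "1 \<le> N" using False s by simp
    have lin: "linear (T ^^ k)" for k
      using T bounded_linear_funpow bounded_linear.linear unfolding bounded_clinear_def by blast
    obtain w D where w: "\<And>k. 0 \<le> w k" "\<And>k. D \<le> k \<Longrightarrow> w k = 0"
      and w1: "\<And>A. finite A \<Longrightarrow> sum w A \<le> 1"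
      and w2: "1 / 2 \<le> sum w {k. N < k + 3 * s \<and> k < N + 3 * s}"
      and wK: "\<And>z y. cmod z = 1 \<Longrightarrow> norm (\<Sum>k<D. w k *\<^sub>R z ^ k *\<^sub>C (T ^^ k) y) \<le> (K + 1) * norm y"
      by (rule concentrated_kernel[OF T K(1) N1 N]) blast
    define W where "W n = sum w {..<n}" for n
    have W: "mono W" "0 \<le> W n" "W n \<le> 1" for n
      unfolding W_def using w w1 by (auto intro!: monoI sum_mono2 sum_nonneg)
    \<comment> \<open>With this start, the \<open>9 s\<close> indices from \<open>a - j\<close> on
      cover the bulk of the mass for every \<open>j \<le> 3 s\<close>, and
      \<open>9 s - 1 + a = N + 6 s - 1\<close> is the exponent at \<open>j = 0\<close>.\<close>
    define a where "a = N - 3 * s"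
    define v where "v j = W (a + 9 * s - j) - W (a - j)" for j
    have v_eq: "v j = sum w {a - j..<a + 9 * s - j}" if "j \<le> 3 * s" for j
      using sum_diff_nat_ivl[of 0 "a - j" "a + 9 * s - j" w] that
      by (simp add: v_def W_def atLeast0LessThan)
    have vhalf: "1 / 2 \<le> v j" if "j \<le> 3 * s" for j
    proof -
      have "{k. N < k + 3 * s \<and> k < N + 3 * s} \<subseteq> {a - j..<a + 9 * s - j}"
        using that False by (auto simp: a_def)
      then have "sum w {k. N < k + 3 * s \<and> k < N + 3 * s} \<le> v j"
        unfolding v_eq[OF that] using w by (intro sum_mono2) auto
      then show ?thesis using w2 by simp
    qed
    define y where "y j = (1 / v j) *\<^sub>R x j" for j
    have y: "Lp_norm p (trig_sum {0..<3 * s} y) \<le> 10 * R * Lp_norm p (trig_sum {0..<3 * s} x)"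
      unfolding y_def v_def
    proof (rule inverse_multiplier_bound)
      show "(\<Sum>k<3 * s. \<bar>W (a + 9 * s - Suc k) - W (a + 9 * s - k)\<bar>) \<le> 1"
        by (rule sum_diff_abs_mono[of "\<lambda>k. W (a + 9 * s - k)"])
          (auto simp: W(2,3) intro!: antimonoI monoD[OF W(1)])
      show "(\<Sum>k<3 * s. \<bar>W (a - Suc k) - W (a - k)\<bar>) \<le> 1"
        by (rule sum_diff_abs_mono[of "\<lambda>k. W (a - k)"])
          (auto simp: W(2,3) intro!: antimonoI monoD[OF W(1)])
    qed (use vhalf in \<open>simp add: v_def\<close>)
    define h where "h l = (\<Sum>k\<le>l. w k *\<^sub>R (T ^^ k) (if l - k < 3 * s then y (l - k) else 0))" for l
    have h: "(T ^^ (9 * s - 1 - i)) (h (i + a)) =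
        (\<Sum>j<3 * s. (if j \<le> i + a then w (i + a - j) else 0) *\<^sub>R (T ^^ (N + 6 * s - 1 - j)) (y j))"
      if i: "i < 9 * s" for i
    proof -
      have h1: "h (i + a) = (\<Sum>j\<le>i + a. w (i + a - j) *\<^sub>R (T ^^ (i + a - j)) (if j < 3 * s then y j else 0))"
        unfolding h_def by (subst sum.atLeastAtMost_rev[of _ 0 "i + a", unfolded atLeast0AtMost]) (auto intro!: sum.cong)
      have "(T ^^ (9 * s - 1 - i)) (h (i + a)) =
         (\<Sum>j\<le>i + a. w (i + a - j) *\<^sub>R (T ^^ (9 * s - 1 - i + (i + a - j))) (if j < 3 * s then y j else 0))"
        unfolding h1 by (simp only: linear_sum[OF lin] linear_cmul[OF lin] funpow_add o_apply)
      also have "\<dots> = (\<Sum>j\<in>{..<3 * s} \<inter> {..i + a}. w (i + a - j) *\<^sub>R (T ^^ (N + 6 * s - 1 - j)) (y j))"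
      proof (rule sum.mono_neutral_cong_right)
        fix j assume j: "j \<in> {..<3 * s} \<inter> {..i + a}"
        then have "9 * s - 1 - i + (i + a - j) = N + 6 * s - 1 - j"
          using i False by (auto simp: a_def)
        then show "w (i + a - j) *\<^sub>R (T ^^ (9 * s - 1 - i + (i + a - j))) (if j < 3 * s then y j else 0) =
            w (i + a - j) *\<^sub>R (T ^^ (N + 6 * s - 1 - j)) (y j)"
          using j by simp
      qed (auto simp: linear_0[OF lin])
      also have "\<dots> = (\<Sum>j<3 * s. (if j \<le> i + a then w (i + a - j) else 0) *\<^sub>R (T ^^ (N + 6 * s - 1 - j)) (y j))"
        by (intro sum.mono_neutral_cong_left) auto
      finally show ?thesis .
    qed
    have v': "(\<Sum>i<9 * s. if j \<le> i + a then w (i + a - j) else 0) = v j" if "j < 3 * s" for j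
    proof -
      have "(\<Sum>i<9 * s. if j \<le> i + a then w (i + a - j) else 0) = (\<Sum>i\<in>{j - a..<9 * s}. w (i + a - j))"
        by (intro sum.mono_neutral_cong_right) auto
      also have "\<dots> = sum w {a - j..<a + 9 * s - j}"
        by (rule sum.reindex_bij_witness[of _ "\<lambda>k. k + j - a" "\<lambda>i. i + a - j"]) (use that in auto)
      finally show ?thesis using that by (simp add: v_eq)
    qed
    have "(\<Sum>k<3 * s. (T ^^ (N + 6 * s - 1 - k)) (x k)) =
        (\<Sum>j<3 * s. v j *\<^sub>R (T ^^ (N + 6 * s - 1 - j)) (y j))"
    proof (rule sum.cong[OF refl])
      fix j assume "j \<in> {..<3 * s}"
      then have "v j \<noteq> 0" using vhalf[of j] by auto
      then show "(T ^^ (N + 6 * s - 1 - j)) (x j) = v j *\<^sub>R (T ^^ (N + 6 * s - 1 - j)) (y j)"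
        by (simp add: y_def linear_cmul[OF lin])
    qed
    also have "\<dots> = (\<Sum>j<3 * s. \<Sum>i<9 * s. (if j \<le> i + a then w (i + a - j) else 0) *\<^sub>R (T ^^ (N + 6 * s - 1 - j)) (y j))"
      by (intro sum.cong refl) (simp only: v'[symmetric] scaleR_sum_left lessThan_iff)
    also have "\<dots> = (\<Sum>i<9 * s. (T ^^ (9 * s - 1 - i)) (h (i + a)))"
      by (subst sum.swap) (intro sum.cong refl, simp only: h lessThan_iff)
    finally have "norm (\<Sum>k<3 * s. (T ^^ (N + 6 * s - 1 - k)) (x k)) =
        norm (\<Sum>i<9 * s. (T ^^ (9 * s - 1 - i)) (h (i + a)))" by simp
    also have "\<dots> \<le> b * Lp_norm p (trig_sum {0..<9 * s} (\<lambda>i. h (i + a)))"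
      using b(1)[unfolded coorbit_bound_def, rule_format, of "\<lambda>i. h (i + a)"] .
    also have "Lp_norm p (trig_sum {0..<9 * s} (\<lambda>i. h (i + a))) = Lp_norm p (trig_sum {0 + a..<9 * s + a} h)"
      by (simp only: Lp_norm_trig_sum_shift[OF p_pos])
    also have "b * \<dots> \<le> b * (R * Lp_norm p (trig_sum {0..<D + 9 * s + a} h))"
      using b by (intro mult_left_mono riesz) auto
    also have "\<dots> \<le> b * (R * ((K + 1) * Lp_norm p (trig_sum {0..<3 * s} y)))"
      unfolding h_def using b R K by (intro mult_left_mono convolution_bound[OF T w(2) _ _ wK]) auto
    also have "\<dots> \<le> b * (R * ((K + 1) * (10 * R * Lp_norm p (trig_sum {0..<3 * s} x))))"
      using b R K by (intro mult_left_mono y) auto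
    finally show ?thesis by (simp add: power2_eq_square algebra_simps)
  qed
qed

end

section \<open>Recursion over square-root scales\<close>

text \<open>A step gains a factor \<open>r\<^sup>\<alpha>\<close> with \<open>r\<close> about \<open>\<surd>t\<close>, so that the steps together contribute
  \<open>t\<^sup>\<alpha> C\<^sup>j\<close>, where the number \<open>j\<close> of steps is about \<open>log log t\<close>; this is the origin of the logarithm.\<close>

lemma square_root_recursion:
  fixes P :: "nat \<Rightarrow> real \<Rightarrow> bool"
  assumes mono: "\<And>t b b'. P t b \<Longrightarrow> b \<le> b' \<Longrightarrow> P t b'"
    and base: "\<And>t. t < 16 \<Longrightarrow> P t B" and B: "0 \<le> B"
    and step: "\<And>r t b. P r b \<Longrightarrow> 0 \<le> b \<Longrightarrow> 1 \<le> r \<Longrightarrow> t \<le> r\<^sup>2 \<Longrightarrow> P t (C * real r powr a * b)"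
    and C: "0 \<le> C" and a: "0 \<le> a" and \<beta>: "0 \<le> \<beta>" "C * 4 powr a * (3 / 4) powr \<beta> \<le> 1"
    and t: "1 \<le> t"
  shows "P t (B * real t powr a * ln (real t + 2) powr \<beta>)"
  using t
proof (induction t rule: less_induct)
  case (less t)
  show ?case
  proof (cases "t < 16")
    case True
    have "exp 1 \<le> real t + 2" using exp_le less.prems by linarith
    then have "1 \<le> ln (real t + 2)" using less.prems by (subst ln_ge_iff) auto
    then have "1 * 1 \<le> real t powr a * ln (real t + 2) powr \<beta>"
      using less.prems a \<beta> by (intro mult_mono ge_one_powr_ge_zero) auto
    then have "B \<le> B * real t powr a * ln (real t + 2) powr \<beta>"
      using mult_left_mono[OF _ B] by (fastforce simp: mult.assoc)
    then show ?thesis using mono base[OF True] by blast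
  next
    case False
    then have t16: "16 \<le> real t" by simp
    define r where "r = nat \<lceil>sqrt t\<rceil>"
    have s4: "4 \<le> sqrt t" using real_sqrt_le_mono[OF t16] by simp
    have r1: "sqrt t \<le> r" "r \<le> sqrt t + 1"
      unfolding r_def using s4 by linarith+
    have "sqrt t * sqrt t \<le> real r * real r" using r1 s4 by (intro mult_mono) auto
    then have "real t \<le> real (r\<^sup>2)" by (simp add: power2_eq_square)
    then have tr: "t \<le> r\<^sup>2" by linarith
    have r2: "real r \<le> 2 * sqrt t" using r1 s4 by linarith
    have "2 * sqrt t < sqrt t * sqrt t" using s4 t16 by (intro mult_strict_right_mono) auto
    then have "r < t" using r2 by simp
    moreover have "1 \<le> r" using r1 s4 by linarith
    ultimately have IH: "P r (B * real r powr a * ln (real r + 2) powr \<beta>)"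
      using less.IH by blast
    have *: "P t (C * real r powr a * (B * real r powr a * ln (real r + 2) powr \<beta>))"
      by (rule step[OF IH _ \<open>1 \<le> r\<close> tr]) (use B in auto)
    have rr: "real r powr a * real r powr a \<le> 4 powr a * real t powr a"
    proof -
      have "real r * real r \<le> (2 * sqrt t) * (2 * sqrt t)" using r2 by (intro mult_mono) auto
      then have "(real r * real r) powr a \<le> (4 * real t) powr a" using a by (intro powr_mono2) auto
      then show ?thesis by (simp add: powr_mult)
    qed
    \<comment> \<open>The exact square root would give a factor near 1/2; 3/4 leaves room for
      rounding and for the summand 2. It needs 2 \<le> t^(1/4), whence the threshold 16.\<close>
    have lnr: "ln (real r + 2) \<le> 3 / 4 * ln (real t + 2)"
    proof -
      have "real r + 2 \<le> 2 * sqrt t" using r1 s4 by linarith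
      also have "\<dots> \<le> real t powr (1 / 4) * sqrt t"
      proof (intro mult_right_mono)
        have "16 powr (1 / 4) \<le> real t powr (1 / 4)" using t16 by (intro powr_mono2) auto
        moreover have "(16::real) powr (1 / 4) = (2 powr 4) powr (1 / 4)" by simp
        then have "(16::real) powr (1 / 4) = 2" unfolding powr_powr by simp
        ultimately show "2 \<le> real t powr (1 / 4)" by simp
      qed simp
      also have "\<dots> = real t powr (3 / 4)"
        using t16 by (simp add: powr_half_sqrt[symmetric] flip: powr_add)
      also have "\<dots> \<le> (real t + 2) powr (3 / 4)" by (intro powr_mono2) auto
      finally have "ln (real r + 2) \<le> ln ((real t + 2) powr (3 / 4))"
        by (subst ln_le_cancel_iff) auto
      then show ?thesis using t16 by (simp add: ln_powr)
    qed
    have l0: "0 \<le> ln (real r + 2)" by simp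
    have "ln (real r + 2) powr \<beta> \<le> (3 / 4 * ln (real t + 2)) powr \<beta>"
      using lnr l0 \<beta> by (intro powr_mono2) auto
    then have lnr': "ln (real r + 2) powr \<beta> \<le> (3 / 4) powr \<beta> * ln (real t + 2) powr \<beta>"
      by (simp only: powr_mult)
    have "C * real r powr a * (B * real r powr a * ln (real r + 2) powr \<beta>) =
        C * B * ((real r powr a * real r powr a) * ln (real r + 2) powr \<beta>)" by simp
    also have "\<dots> \<le> C * B * ((4 powr a * real t powr a) * ((3 / 4) powr \<beta> * ln (real t + 2) powr \<beta>))"
      using C B by (intro mult_left_mono mult_mono rr lnr') auto
    also have "\<dots> = (C * 4 powr a * (3 / 4) powr \<beta>) * (B * real t powr a * ln (real t + 2) powr \<beta>)"
      by simp
    also have "\<dots> \<le> 1 * (B * real t powr a * ln (real t + 2) powr \<beta>)"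
      using B by (intro mult_right_mono \<beta>) auto
    finally show ?thesis using mono[OF *] by simp
  qed
qed

text \<open>Each step of the recursion shrinks the logarithm by 3/4, so a sufficiently high power of
  it absorbs the constant lost in the step.\<close>

lemma exists_log_exponent:
  fixes C :: real
  assumes "0 \<le> C"
  obtains \<beta> where "0 < \<beta>" "C * (3 / 4) powr \<beta> \<le> 1"
proof -
  define x where "x = 1 + ln (C + 1) / ln (4 / 3)"
  have l: "ln (3 / 4 :: real) = - ln (4 / 3)" by (simp add: ln_div)
  have x: "0 < x" using assms by (simp add: x_def add_pos_nonneg)
  have "ln (C + 1) \<le> x * ln (4 / 3)" by (simp add: x_def distrib_right)
  then have "(3 / 4) powr x \<le> exp (- ln (C + 1))"
    by (simp add: powr_def l)
  also have "\<dots> = 1 / (C + 1)" using assms by (simp add: exp_minus inverse_eq_divide)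
  finally have "C * (3 / 4) powr x \<le> C * (1 / (C + 1))"
    using assms by (rule mult_left_mono)
  also have "\<dots> \<le> 1" using assms by simp
  finally show ?thesis using that x by blast
qed

section \<open>Growth of orbit and coorbit polynomials, and of the powers\<close>

context interval_estimates
begin

text \<open>With \<open>s = 9 r\<close> the windows have length \<open>3 s = 27 r\<close>, and \<open>3 r\<close> of them cover \<open>81 r\<^sup>2\<close>; the
  offset \<open>N\<close> of each stays below \<open>s\<^sup>2\<close>.\<close>

lemma orbit_step:
  fixes T :: "'a \<Rightarrow> 'a"
  assumes T: "bounded_clinear T" and K: "strongly_Kreiss_bounded K T" "0 \<le> K"
    and b: "orbit_bound p T (81 * r) b" "0 \<le> b" and r: "1 \<le> r" and t: "t \<le> r\<^sup>2"
  shows "orbit_bound p T (81 * t) (R * U * 3 powr a0 * (10 * R\<^sup>2 * (K + 1)) * real r powr a0 * b)"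
  unfolding orbit_bound_def
proof
  fix x
  let ?c = "10 * R\<^sup>2 * (K + 1)"
  let ?y = "\<lambda>k. (T ^^ k) x"
  have b': "orbit_bound p T (9 * (9 * r)) b" using b by simp
  have "1 * 1 \<le> R * (K + 1)" using R K(2) by (intro mult_mono) auto
  then have "R * 1 \<le> R * (10 * (R * (K + 1)))" using R by (intro mult_left_mono) linarith+
  then have c: "R \<le> ?c" by (simp add: power2_eq_square algebra_simps)
  have "Lp_norm p (trig_sum {0..<(3 * r) * (27 * r)} ?y) \<le> U * real (3 * r) powr a0 * (?c * b * norm x)"
  proof (rule upper)
    fix i assume i: "i < 3 * r"
    show "Lp_norm p (trig_sum {i * (27 * r)..<i * (27 * r) + 27 * r} ?y) \<le> ?c * b * norm x"
    proof (cases i)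
      \<comment> \<open>\<open>orbit_window\<close> starts at \<open>N + 3 s\<close>, that is, one
        block length after \<open>N\<close>. It yields block \<open>j + 1\<close> for
        \<open>N = j * (27 * r)\<close> and misses the initial block, which is a projection of the
        short orbit.\<close>
      case 0
      have "Lp_norm p (trig_sum {0..<27 * r} ?y) \<le> R * Lp_norm p (trig_sum {0..<81 * r} ?y)"
        by (rule riesz) simp
      also have "\<dots> \<le> R * (b * norm x)"
        using b(1) R unfolding orbit_bound_def by (intro mult_left_mono) auto
      also have "\<dots> \<le> ?c * (b * norm x)"
        using b(2) by (intro mult_right_mono c) auto
      finally show ?thesis using 0 by (simp add: mult.assoc)
    next
      case (Suc j)
      have "j * (27 * r) \<le> (3 * r) * (27 * r)" using i Suc by (intro mult_right_mono) auto
      then have "j * (27 * r) \<le> (9 * r)\<^sup>2" by (simp add: power2_eq_square)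
      from orbit_window[OF T K b' b(2) this, of x]
      have "Lp_norm p (trig_sum {0..<27 * r} (\<lambda>k. ?y (k + i * (27 * r)))) \<le> ?c * b * norm x"
        by (simp add: Suc algebra_simps)
      then show ?thesis
        using Lp_norm_trig_sum_shift[OF p_pos, of 0 "i * (27 * r)" "27 * r" ?y] by (simp add: add.commute)
    qed
  qed (use r b K in auto)
  moreover have "Lp_norm p (trig_sum {0..<81 * t} ?y) \<le> R * Lp_norm p (trig_sum {0..<(3 * r) * (27 * r)} ?y)"
    by (rule riesz) (use t in \<open>simp add: power2_eq_square\<close>)
  ultimately have "Lp_norm p (trig_sum {0..<81 * t} ?y) \<le> R * (U * real (3 * r) powr a0 * (?c * b * norm x))"
    using R mult_left_mono[of _ _ R] by (meson order_trans zero_le_one)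
  then show "Lp_norm p (trig_sum {0..<81 * t} ?y) \<le>
      R * U * 3 powr a0 * (10 * R\<^sup>2 * (K + 1)) * real r powr a0 * b * norm x"
    by (simp add: powr_mult mult_ac)
qed

text \<open>On each block the map is a coorbit window, with an offset counted from the end because
  the exponents decrease. The triangle inequality adds the blocks, and \<open>lower\<close> bounds
  the sum of their norms by the norm of the whole polynomial.\<close>

lemma coorbit_step:
  fixes T :: "'a \<Rightarrow> 'a"
  assumes T: "bounded_clinear T" and K: "strongly_Kreiss_bounded K T" "0 \<le> K"
    and b: "coorbit_bound p T (81 * r) b" "0 \<le> b" and r: "1 \<le> r" and t: "t \<le> r\<^sup>2"
  shows "coorbit_bound p T (81 * t) (L * 3 powr a1 * (10 * R\<^sup>2 * (K + 1)) * real r powr a1 * b)"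
proof -
  let ?c = "10 * R\<^sup>2 * (K + 1)"
  define m l where "m = 3 * r" and "l = 27 * r"
  have b': "coorbit_bound p T (9 * (9 * r)) b" using b by simp
  have ml: "m * l = 81 * r\<^sup>2" by (simp add: m_def l_def power2_eq_square)
  have C: "coorbit_bound p T (m * l) (L * 3 powr a1 * ?c * real r powr a1 * b)"
    unfolding coorbit_bound_def
  proof
    fix c :: "nat \<Rightarrow> 'a"
    have block: "norm (\<Sum>k\<in>{i * l..<i * l + l}. (T ^^ (m * l - 1 - k)) (c k)) \<le>
        ?c * b * Lp_norm p (trig_sum {i * l..<i * l + l} c)" if i: "i < m" for i
    proof -
      have eq: "(\<Sum>k\<in>{i * l..<i * l + l}. (T ^^ (m * l - 1 - k)) (c k)) =
          (\<Sum>k<l. (T ^^ (m * l - 1 - (k + i * l))) (c (k + i * l)))"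
        using sum.shift_bounds_nat_ivl[of "\<lambda>k. (T ^^ (m * l - 1 - k)) (c k)" 0 "i * l" l]
        by (simp add: atLeast0LessThan add.commute)
      have eq2: "Lp_norm p (trig_sum {i * l..<i * l + l} c) = Lp_norm p (trig_sum {0..<l} (\<lambda>k. c (k + i * l)))"
        using Lp_norm_trig_sum_shift[OF p_pos, of 0 "i * l" l c] by (simp add: add.commute)
      show ?thesis
      proof (cases "i = m - 1")
        \<comment> \<open>The last block carries the exponents below \<open>l\<close>, which no
          window reaches; it is the tail of a coorbit of length \<open>81 r\<close>, after the first
          \<open>54 r\<close> places.\<close>
        case True
        then have "m * l = i * l + l" using i by (cases m) auto
        then have "(\<Sum>k<l. (T ^^ (m * l - 1 - (k + i * l))) (c (k + i * l))) =
            (\<Sum>k<l. (T ^^ (9 * (9 * r) - 1 - (6 * (9 * r) + k))) (c (k + i * l)))"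
          by (intro sum.cong refl) (simp add: l_def)
        also have "norm \<dots> \<le> b * Lp_norm p (trig_sum {0..<l} (\<lambda>k. c (k + i * l)))"
          by (rule coorbit_bound_sub[OF T p_pos b']) (simp add: l_def)
        also have "\<dots> \<le> ?c * (b * Lp_norm p (trig_sum {0..<l} (\<lambda>k. c (k + i * l))))"
          using b mult_right_mono[OF one_le_window_const[OF K(2)],
              of "b * Lp_norm p (trig_sum {0..<l} (\<lambda>k. c (k + i * l)))"] by simp
        finally show ?thesis unfolding eq eq2 by (simp add: mult.assoc)
      next
        case False
        \<comment> \<open>The number of blocks after block \<open>i\<close>, less one: a window has
          its lowest exponent at offset plus \<open>l\<close>, since \<open>3 s = l\<close>.\<close>
        define j where "j = m - 2 - i"
        have "m = j + 2 + i" using i False by (simp add: j_def)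
        then have e: "m * l = j * l + 2 * l + i * l" by (simp add: algebra_simps)
        have "j * (27 * r) \<le> (3 * r) * (27 * r)"
          by (intro mult_right_mono) (auto simp: j_def m_def)
        then have N: "j * l \<le> (9 * r)\<^sup>2" by (simp add: power2_eq_square l_def)
        have "m * l - 1 - (k + i * l) = j * l + 6 * (9 * r) - 1 - k" for k
          unfolding e by (simp add: l_def)
        then have "(\<Sum>k<l. (T ^^ (m * l - 1 - (k + i * l))) (c (k + i * l))) =
            (\<Sum>k<3 * (9 * r). (T ^^ (j * l + 6 * (9 * r) - 1 - k)) (c (k + i * l)))"
          by (simp only:) (simp add: l_def)
        also have "norm \<dots> \<le> ?c * b * Lp_norm p (trig_sum {0..<3 * (9 * r)} (\<lambda>k. c (k + i * l)))"
          by (rule coorbit_window[OF T K b' b(2) N])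
        finally show ?thesis unfolding eq eq2 by (simp add: l_def)
      qed
    qed
    have "norm (\<Sum>k<m * l. (T ^^ (m * l - 1 - k)) (c k)) =
        norm (\<Sum>i<m. \<Sum>k\<in>{i * l..<i * l + l}. (T ^^ (m * l - 1 - k)) (c k))"
      by (simp only: sum.nat_group)
    also have "\<dots> \<le> (\<Sum>i<m. ?c * b * Lp_norm p (trig_sum {i * l..<i * l + l} c))"
      by (intro sum_norm_le block) auto
    also have "\<dots> = ?c * b * (\<Sum>i<m. Lp_norm p (trig_sum {i * l..<i * l + l} c))"
      by (simp add: sum_distrib_left)
    also have "\<dots> \<le> ?c * b * (L * real m powr a1 * Lp_norm p (trig_sum {0..<m * l} c))"
      using b K r by (intro mult_left_mono lower) (auto simp: l_def)
    finally show "norm (\<Sum>k<m * l. (T ^^ (m * l - 1 - k)) (c k)) \<le>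
        L * 3 powr a1 * ?c * real r powr a1 * b * Lp_norm p (trig_sum {0..<m * l} c)"
      by (simp add: m_def powr_mult mult_ac)
  qed
  show ?thesis
    unfolding coorbit_bound_def
  proof
    fix c :: "nat \<Rightarrow> 'a"
    have "(\<Sum>k<81 * t. (T ^^ (81 * t - 1 - k)) (c k)) =
        (\<Sum>k<81 * t. (T ^^ (m * l - 1 - ((81 * r\<^sup>2 - 81 * t) + k))) (c k))"
      using t by (intro sum.cong refl) (simp add: ml)
    also have "norm \<dots> \<le> L * 3 powr a1 * ?c * real r powr a1 * b * Lp_norm p (trig_sum {0..<81 * t} c)"
      by (rule coorbit_bound_sub[OF T p_pos C]) (use t in \<open>simp add: ml\<close>)
    finally show "norm (\<Sum>k<81 * t. (T ^^ (81 * t - 1 - k)) (c k)) \<le>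
        L * 3 powr a1 * ?c * real r powr a1 * b * Lp_norm p (trig_sum {0..<81 * t} c)" .
  qed
qed

lemma trivial_bounds:
  fixes T :: "'a \<Rightarrow> 'a"
  assumes \<tau>: "\<And>x. norm (T x) \<le> \<tau> * norm x" "1 \<le> \<tau>"
  shows "norm ((T ^^ k) x) \<le> \<tau> ^ k * norm x"
    and "orbit_bound p T n (n * \<tau> ^ n)"
    and "coorbit_bound p T n (n * \<tau> ^ n * R)"
proof -
  show pow: "norm ((T ^^ k) x) \<le> \<tau> ^ k * norm x" for k x
  proof (induction k)
    case (Suc k)
    have "norm ((T ^^ Suc k) x) \<le> \<tau> * norm ((T ^^ k) x)" using \<tau>(1) by simp
    also have "\<dots> \<le> \<tau> * (\<tau> ^ k * norm x)" using \<tau>(2) by (intro mult_left_mono Suc) auto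
    finally show ?case by simp
  qed simp
  have pow': "norm ((T ^^ k) x) \<le> \<tau> ^ n * norm x" if "k \<le> n" for k x
    by (rule order_trans[OF pow mult_right_mono[OF power_increasing[OF that \<tau>(2)] norm_ge_zero]])
  show "orbit_bound p T n (n * \<tau> ^ n)"
    unfolding orbit_bound_def
  proof
    fix x
    have "Lp_norm p (trig_sum {0..<n} (\<lambda>k. (T ^^ k) x)) \<le> (n * \<tau> ^ n) * Lp_norm p (\<lambda>t. x)"
    proof (intro Lp_norm_mono p_pos continuous_intros)
      show "norm (trig_sum {0..<n} (\<lambda>k. (T ^^ k) x) t) \<le> (n * \<tau> ^ n) * norm x" for t
      proof -
        have "norm (trig_sum {0..<n} (\<lambda>k. (T ^^ k) x) t) \<le> (\<Sum>k\<in>{0..<n}. \<tau> ^ n * norm x)"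
          unfolding trig_sum_def by (intro sum_norm_le) (auto simp: norm_scaleC intro!: pow')
        then show ?thesis by simp
      qed
    qed (use \<tau> in auto)
    also have "Lp_norm p (\<lambda>t. x) = norm x" by (rule Lp_norm_const[OF p_pos]) simp
    finally show "Lp_norm p (trig_sum {0..<n} (\<lambda>k. (T ^^ k) x)) \<le> n * \<tau> ^ n * norm x" .
  qed
  show "coorbit_bound p T n (n * \<tau> ^ n * R)"
    unfolding coorbit_bound_def
  proof
    fix c :: "nat \<Rightarrow> 'a"
    have "norm ((T ^^ (n - 1 - k)) (c k)) \<le> \<tau> ^ n * (R * Lp_norm p (trig_sum {0..<n} c))" if "k < n" for k
    proof -
      have "norm ((T ^^ (n - 1 - k)) (c k)) \<le> \<tau> ^ n * norm (c k)" by (rule pow') simp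
      also have "\<dots> \<le> \<tau> ^ n * (R * Lp_norm p (trig_sum {0..<n} c))"
        using \<tau> by (intro mult_left_mono norm_coeff_le that) auto
      finally show ?thesis .
    qed
    then have "norm (\<Sum>k<n. (T ^^ (n - 1 - k)) (c k)) \<le> (\<Sum>k<n. \<tau> ^ n * (R * Lp_norm p (trig_sum {0..<n} c)))"
      by (intro sum_norm_le) auto
    then show "norm (\<Sum>k<n. (T ^^ (n - 1 - k)) (c k)) \<le> n * \<tau> ^ n * R * Lp_norm p (trig_sum {0..<n} c)"
      by (simp add: mult_ac)
  qed
qed

text \<open>The coorbit map is applied to a window of the orbit itself. The decreasing exponents of
  the one compensate the increasing exponents of the other, so all \<open>27 r\<close> summands
  equal the same vector \<open>(T ^^ n) x\<close> and their norms add up without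
  cancellation.\<close>

lemma power_growth_large:
  fixes T :: "'a \<Rightarrow> 'a"
  assumes T: "bounded_clinear T" and K: "strongly_Kreiss_bounded K T" "0 \<le> K"
    and o: "orbit_bound p T (81 * r) b" "0 \<le> b" and c: "coorbit_bound p T (81 * r) b'" "0 \<le> b'"
    and n: "81 * r \<le> n + 1" "n \<le> r\<^sup>2" and r: "1 \<le> r"
  shows "real r * onorm (T ^^ n) \<le> 10 * R\<^sup>2 * (K + 1) * b * b'"
proof -
  have lin: "linear (T ^^ k)" for k
    using T bounded_linear_funpow bounded_linear.linear unfolding bounded_clinear_def by blast
  let ?c = "10 * R\<^sup>2 * (K + 1)"
  define N where "N = n + 1 - 81 * r"
  have N: "N \<le> (9 * r)\<^sup>2" using n r by (simp add: N_def power2_eq_square)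
  have o': "orbit_bound p T (9 * (9 * r)) b" and c': "coorbit_bound p T (9 * (9 * r)) b'"
    using o c by simp_all
  have "norm ((T ^^ n) x) \<le> ?c * b * b' / r * norm x" for x
  proof -
    let ?y = "\<lambda>k. (T ^^ (k + (N + 3 * (9 * r)))) x"
    have "(T ^^ (9 * (9 * r) - 1 - (3 * (9 * r) + k))) (?y k) = (T ^^ n) x" if "k < 3 * (9 * r)" for k
    proof -
      have e: "9 * (9 * r) - 1 - (3 * (9 * r) + k) + (k + (N + 3 * (9 * r))) = n"
        using that n r by (simp add: N_def)
      show ?thesis by (subst e[symmetric]) (simp only: funpow_add o_apply)
    qed
    then have "(\<Sum>k<3 * (9 * r). (T ^^ (9 * (9 * r) - 1 - (3 * (9 * r) + k))) (?y k)) =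
        real (3 * (9 * r)) *\<^sub>R (T ^^ n) x"
      by (simp add: sum_constant_scaleR del: of_nat_mult)
    then have "real (3 * (9 * r)) * norm ((T ^^ n) x) =
        norm (\<Sum>k<3 * (9 * r). (T ^^ (9 * (9 * r) - 1 - (3 * (9 * r) + k))) (?y k))"
      by simp
    also have "\<dots> \<le> b' * Lp_norm p (trig_sum {0..<3 * (9 * r)} ?y)"
      by (rule coorbit_bound_sub[OF T p_pos c']) simp
    also have "\<dots> \<le> b' * (?c * b * norm x)"
      by (intro mult_left_mono orbit_window[OF T K o' o(2) N] c(2))
    finally have "27 * (real r * norm ((T ^^ n) x)) \<le> ?c * b * b' * norm x"
      by (simp add: mult_ac)
    moreover have "0 \<le> real r * norm ((T ^^ n) x)" by simp
    ultimately have "real r * norm ((T ^^ n) x) \<le> ?c * b * b' * norm x" by linarith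
    then show ?thesis using r by (simp add: field_simps)
  qed
  then have "onorm (T ^^ n) \<le> ?c * b * b' / r"
    by (intro onorm_bound) (use K o c in auto)
  then show ?thesis using r by (simp add: field_simps)
qed

lemma power_growth:
  assumes K: "0 \<le> K"
  shows "\<exists>C>0. \<exists>\<beta>>0. \<forall>T :: 'a \<Rightarrow> 'a. bounded_clinear T \<and> strongly_Kreiss_bounded K T \<longrightarrow>
    (\<forall>n\<ge>1. onorm (T ^^ n) \<le> C * real n powr (1 / 2 * (a0 + a1 - 1)) * ln (real n + 2) powr \<beta>)"
proof -
  define \<tau> where "\<tau> = max 1 (2 * exp 1 * R * (K + 1))"
  define c where "c = 10 * R\<^sup>2 * (K + 1)"
  define C0 where "C0 = R * U * 3 powr a0 * c"
  define C1 where "C1 = L * 3 powr a1 * c"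
  \<comment> \<open>The recursion starts below \<open>t = 16\<close>, that is, with polynomials
    shorter than 81 * 16 = 1296; the factor \<open>R\<close> comes from the trivial coorbit
    bound.\<close>
  define B where "B = 1296 * \<tau> ^ 1296 * R"
  define e where "e = a0 + a1 - 1"
  have \<tau>: "1 \<le> \<tau>" by (simp add: \<tau>_def)
  have c: "0 < c" using K R by (simp add: c_def)
  have C01: "0 \<le> C0" "0 \<le> C1" using UL R c by (auto simp: C0_def C1_def)
  have B: "1 \<le> B"
  proof -
    have "1 * 1 * 1 \<le> 1296 * \<tau> ^ 1296 * R"
      using R one_le_power[OF \<tau>, of 1296] by (intro mult_mono) auto
    then show ?thesis by (simp add: B_def)
  qed
  obtain \<beta>0 where \<beta>0: "0 < \<beta>0" "C0 * 4 powr a0 * (3 / 4) powr \<beta>0 \<le> 1"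
    using exists_log_exponent[of "C0 * 4 powr a0"] C01 by auto
  obtain \<beta>1 where \<beta>1: "0 < \<beta>1" "C1 * 4 powr a1 * (3 / 4) powr \<beta>1 \<le> 1"
    using exists_log_exponent[of "C1 * 4 powr a1"] C01 by auto
  \<comment> \<open>The exponent \<open>e\<close> may have either sign. The absolute value covers
    both cases, in the comparison of \<open>r\<close> with \<open>sqrt n\<close> as well as for
    \<open>n\<close> below 10000.\<close>
  define D1 where "D1 = c * B\<^sup>2 * 2 powr \<bar>e\<bar>"
  define D2 where "D2 = \<tau> ^ 10000 * 10000 powr \<bar>e\<bar>"
  have D: "0 < D1" "0 < D2" using c B \<tau> by (auto simp: D1_def D2_def)
  have main: "onorm (T ^^ n) \<le> (D1 + D2) * real n powr (1 / 2 * e) * ln (real n + 2) powr (\<beta>0 + \<beta>1)"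
    if T: "bounded_clinear T" and KT: "strongly_Kreiss_bounded K T" and n: "1 \<le> n" for T :: "'a \<Rightarrow> 'a" and n
  proof -
    have \<tau>T: "norm (T x) \<le> \<tau> * norm x" for x
    proof -
      have "norm (T x) \<le> 2 * exp 1 * R * (K + 1) * norm x" by (rule norm_operator_le[OF T KT K])
      also have "\<dots> \<le> \<tau> * norm x" by (intro mult_right_mono) (auto simp: \<tau>_def)
      finally show ?thesis .
    qed
    note triv = trivial_bounds[OF \<tau>T \<tau>]
    have l1: "1 \<le> ln (real n + 2)"
      using n exp_le by (subst ln_ge_iff) auto
    have lb: "1 \<le> ln (real n + 2) powr (\<beta>0 + \<beta>1)"
      using l1 \<beta>0 \<beta>1 by (intro ge_one_powr_ge_zero) auto
    show ?thesis
    proof (cases "n < 10000")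
      case True
      have "onorm (T ^^ n) \<le> \<tau> ^ n" by (intro onorm_bound triv(1)) (use \<tau> in auto)
      also have "\<dots> \<le> \<tau> ^ 10000" using True \<tau> by (intro power_increasing) auto
      also have "\<dots> \<le> D2 * real n powr (1 / 2 * e)"
      proof -
        have "10000 powr \<bar>e\<bar> * real n powr (1 / 2 * e) \<ge> 10000 powr \<bar>e\<bar> * 10000 powr (- \<bar>e\<bar>)"
        proof (intro mult_left_mono)
          have "(10000::real) powr (- \<bar>e\<bar>) \<le> real n powr (- \<bar>e\<bar>)"
            using n True by (intro powr_mono2') auto
          also have "\<dots> \<le> real n powr (1 / 2 * e)"
            using n by (intro powr_mono) auto
          finally show "(10000::real) powr (- \<bar>e\<bar>) \<le> real n powr (1 / 2 * e)" .
        qed simp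
        then have "1 \<le> 10000 powr \<bar>e\<bar> * real n powr (1 / 2 * e)"
          by (simp flip: powr_add)
        then show ?thesis using \<tau> mult_left_mono[of 1 _ "\<tau> ^ 10000"] by (simp add: D2_def mult.assoc)
      qed
      also have "\<dots> \<le> (D1 + D2) * real n powr (1 / 2 * e)"
        using D by (intro mult_right_mono) auto
      also have "\<dots> * 1 \<le> \<dots> * ln (real n + 2) powr (\<beta>0 + \<beta>1)"
        using D by (intro mult_left_mono lb) auto
      finally show ?thesis by simp
    next
      case False
      \<comment> \<open>The windows must fit on both sides: \<open>n \<le> r\<^sup>2\<close> and
        \<open>81 * r \<le> n + 1\<close>. The latter follows from \<open>r \<le> sqrt n + 1\<close>
        once \<open>sqrt n\<close> is at least 100.\<close>
      define r where "r = nat \<lceil>sqrt n\<rceil>"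
      have "sqrt (100 ^ 2) \<le> sqrt n" using False by (intro real_sqrt_le_mono) auto
      then have s100: "100 \<le> sqrt n" by simp
      have r: "sqrt n \<le> r" "r \<le> sqrt n + 1" unfolding r_def using s100 by linarith+
      have r1: "1 \<le> r" using r s100 by linarith
      have "sqrt n * sqrt n \<le> real r * real r" using r s100 by (intro mult_mono) auto
      then have "real n \<le> real (r\<^sup>2)" by (simp add: power2_eq_square)
      then have nr: "n \<le> r\<^sup>2" by linarith
      have s: "100 * sqrt n \<le> n"
        using mult_right_mono[OF s100, of "sqrt n"] by simp
      have "real (81 * r) \<le> real (n + 1)" using r s s100 by simp
      then have rn: "81 * r \<le> n + 1" by linarith
      have rlen: "real r \<le> n" using r s s100 by linarith
      define b0 where "b0 = B * real r powr a0 * ln (real r + 2) powr \<beta>0"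
      define b1 where "b1 = B * real r powr a1 * ln (real r + 2) powr \<beta>1"
      have base: "real (81 * t) * \<tau> ^ (81 * t) * 1 \<le> B" "real (81 * t) * \<tau> ^ (81 * t) * R \<le> B" if "t < 16" for t
        unfolding B_def using that R \<tau> by (intro mult_mono power_increasing; simp)+
      have o: "orbit_bound p T (81 * r) b0"
        unfolding b0_def
      proof (rule square_root_recursion[where P = "\<lambda>t. orbit_bound p T (81 * t)" and C = C0])
        show "orbit_bound p T (81 * t) b'" if "orbit_bound p T (81 * t) b" "b \<le> b'" for t b b'
          using that unfolding orbit_bound_def by (meson mult_right_mono norm_ge_zero order_trans)
        then show "orbit_bound p T (81 * t) B" if "t < 16" for t
          using triv(2)[of "81 * t"] base(1)[OF that] by simp
        show "orbit_bound p T (81 * t) (C0 * real r powr a0 * b)"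
          if "orbit_bound p T (81 * r) b" "0 \<le> b" "1 \<le> r" "t \<le> r\<^sup>2" for r t b
          unfolding C0_def c_def by (rule orbit_step[OF T KT K that])
      qed (use B C01 a01 \<beta>0 r1 in auto)
      have c': "coorbit_bound p T (81 * r) b1"
        unfolding b1_def
      proof (rule square_root_recursion[where P = "\<lambda>t. coorbit_bound p T (81 * t)" and C = C1])
        show "coorbit_bound p T (81 * t) b'" if "coorbit_bound p T (81 * t) b" "b \<le> b'" for t b b'
          using that unfolding coorbit_bound_def by (meson mult_right_mono Lp_norm_nonneg order_trans)
        then show "coorbit_bound p T (81 * t) B" if "t < 16" for t
          using triv(3)[of "81 * t"] base(2)[OF that] by blast
        show "coorbit_bound p T (81 * t) (C1 * real r powr a1 * b)"
          if "coorbit_bound p T (81 * r) b" "0 \<le> b" "1 \<le> r" "t \<le> r\<^sup>2" for r t b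
          unfolding C1_def c_def by (rule coorbit_step[OF T KT K that])
      qed (use B C01 a01 \<beta>1 r1 in auto)
      have "real r * onorm (T ^^ n) \<le> c * b0 * b1"
        unfolding c_def
        by (rule power_growth_large[OF T KT K o _ c' _ rn nr r1]) (use B in \<open>auto simp: b0_def b1_def\<close>)
      \<comment> \<open>Since \<open>a0 + a1 = 1 + e\<close>, one factor \<open>r\<close> splits off
        and cancels the \<open>r\<close> summands of the composition.\<close>
      also have "\<dots> = real r * (c * B\<^sup>2 * real r powr e * ln (real r + 2) powr (\<beta>0 + \<beta>1))"
      proof -
        have "real r powr a0 * real r powr a1 = real r powr 1 * real r powr e"
          unfolding powr_add[symmetric] by (simp add: e_def)
        then have "real r powr a0 * real r powr a1 = real r * real r powr e" by simp
        then have "c * B\<^sup>2 * (real r powr a0 * real r powr a1) * ln (real r + 2) powr (\<beta>0 + \<beta>1) =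
            c * B\<^sup>2 * (real r * real r powr e) * ln (real r + 2) powr (\<beta>0 + \<beta>1)" by simp
        then show ?thesis by (simp add: b0_def b1_def powr_add power2_eq_square mult_ac)
      qed
      finally have "onorm (T ^^ n) \<le> c * B\<^sup>2 * real r powr e * ln (real r + 2) powr (\<beta>0 + \<beta>1)"
        using r1 by simp
      also have "\<dots> \<le> c * B\<^sup>2 * (2 powr \<bar>e\<bar> * real n powr (1 / 2 * e)) * ln (real n + 2) powr (\<beta>0 + \<beta>1)"
      proof (intro mult_mono mult_left_mono)
        have sn: "sqrt n powr e = real n powr (1 / 2 * e)"
          by (simp add: powr_half_sqrt[symmetric] powr_powr)
        show "real r powr e \<le> 2 powr \<bar>e\<bar> * real n powr (1 / 2 * e)"
        proof (cases "0 \<le> e")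
          case True
          have "real r powr e \<le> (2 * sqrt n) powr e" using r s100 True by (intro powr_mono2) auto
          then show ?thesis using True by (simp add: powr_mult sn)
        next
          case False
          have "real r powr e \<le> sqrt n powr e" using r s100 False by (intro powr_mono2') auto
          moreover have "1 \<le> 2 powr \<bar>e\<bar>" by (intro ge_one_powr_ge_zero) auto
          ultimately show ?thesis unfolding sn
            by (smt (verit) mult_le_cancel_right1 powr_ge_zero)
        qed
        show "ln (real r + 2) powr (\<beta>0 + \<beta>1) \<le> ln (real n + 2) powr (\<beta>0 + \<beta>1)"
          using rlen \<beta>0 \<beta>1 by (intro powr_mono2) auto
      qed (use c in auto)
      also have "\<dots> = D1 * (real n powr (1 / 2 * e) * ln (real n + 2) powr (\<beta>0 + \<beta>1))"
        by (simp add: D1_def)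
      also have "\<dots> \<le> (D1 + D2) * (real n powr (1 / 2 * e) * ln (real n + 2) powr (\<beta>0 + \<beta>1))"
        using D by (intro mult_right_mono) auto
      finally show ?thesis by (simp only: mult.assoc)
    qed
  qed
  show ?thesis
    using main D \<beta>0(1) \<beta>1(1) unfolding e_def
    by (intro exI[of _ "D1 + D2"] conjI exI[of _ "\<beta>0 + \<beta>1"]) auto
qed

end

section \<open>The theorem\<close>

lemma strongly_Kreiss_bounded_mono:
  assumes "strongly_Kreiss_bounded K T" "K \<le> K'"
  shows "strongly_Kreiss_bounded K' T"
proof -
  have "K / (cmod \<mu> - 1) ^ n \<le> K' / (cmod \<mu> - 1) ^ n" if "1 < cmod \<mu>" for \<mu> n
    using assms(2) that by (intro divide_right_mono) auto
  then show ?thesis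
    using assms(1) unfolding strongly_Kreiss_bounded_def by (meson order_trans)
qed

section \<open>Equal blocks as families of disjoint integer intervals\<close>

lemma disjoint_intervals_image:
  fixes f :: "nat \<Rightarrow> int"
  assumes "mono f" "finite A"
  shows "disjoint_intervals ((\<lambda>i. {f i..<f (Suc i)}) ` A)"
proof -
  have "{f i..<f (Suc i)} \<inter> {f j..<f (Suc j)} = {}" if "i < j" for i j
    using monoD[OF assms(1), of "Suc i" j] that by auto
  then have d: "{f i..<f (Suc i)} \<inter> {f j..<f (Suc j)} = {}" if "i \<noteq> j" for i j
    using that by (metis inf_commute nat_neq_iff)
  have "disjoint ((\<lambda>i. {f i..<f (Suc i)}) ` A)"
  proof (rule disjointI)
    fix S S' assume "S \<in> (\<lambda>i. {f i..<f (Suc i)}) ` A" "S' \<in> (\<lambda>i. {f i..<f (Suc i)}) ` A" "S \<noteq> S'"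
    then obtain i j where "S = {f i..<f (Suc i)}" "S' = {f j..<f (Suc j)}" "i \<noteq> j" by blast
    then show "S \<inter> S' = {}" using d by simp
  qed
  then show ?thesis
    using \<open>finite A\<close> by (auto simp: disjoint_intervals_def int_interval_def)
qed

text \<open>Injectivity makes the family of blocks have exactly \<open>m\<close> members and lets
  sums over it be indexed by \<open>i\<close>; it relies on the blocks being nonempty.\<close>

lemma disjoint_intervals_blocks:
  fixes l :: nat
  assumes "1 \<le> l"
  defines "I \<equiv> \<lambda>i. {int (i * l)..<int (i * l + l)}"
  shows "disjoint_intervals (I ` {..<m})" "inj_on I {..<m}" "\<Union> (I ` {..<m}) = int ` {0..<m * l}"
proof -
  have "I = (\<lambda>i. {int (i * l)..<int (Suc i * l)})" by (auto simp: I_def)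
  moreover have "mono (\<lambda>i. int (i * l))" by (intro monoI) (simp add: mult_right_mono)
  ultimately show "disjoint_intervals (I ` {..<m})"
    using disjoint_intervals_image[of "\<lambda>i. int (i * l)" "{..<m}"] by simp
  show "inj_on I {..<m}"
  proof (rule inj_onI)
    fix i j assume "I i = I j"
    then have "int (i * l) = int (j * l)"
      using assms(1) unfolding I_def by (intro atLeastLessThan_inj(1)) auto
    then show "i = j" using assms(1) by simp
  qed
  show "\<Union> (I ` {..<m}) = int ` {0..<m * l}"
  proof (intro equalityI subsetI)
    fix n assume "n \<in> \<Union> (I ` {..<m})"
    then obtain i where i: "i < m" "int (i * l) \<le> n" "n < int (i * l + l)" by (auto simp: I_def)
    have "0 \<le> n" using i(2) of_nat_0_le_iff order_trans by blast
    then obtain k where k: "n = int k" by (metis zero_le_imp_eq_int)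
    have "Suc i * l \<le> m * l" using i by (intro mult_right_mono) auto
    moreover have "k < i * l + l" using i(3) unfolding k by (simp only: of_nat_less_iff)
    ultimately have "k \<in> {0..<m * l}" by simp
    then show "n \<in> int ` {0..<m * l}" unfolding k by blast
  next
    fix n assume "n \<in> int ` {0..<m * l}"
    then obtain k where k: "n = int k" "k < m * l" by auto
    then have "k div l < m" using assms(1) by (simp add: less_mult_imp_div_less)
    moreover have "(k div l) * l \<le> k" "k < (k div l) * l + l"
      using assms(1) dividend_less_div_times[of l k] by (simp_all add: add.commute)
    moreover from this have "n \<in> I (k div l)"
      unfolding I_def k(1) by (simp only: atLeastLessThan_iff of_nat_le_iff of_nat_less_iff)
    ultimately show "n \<in> \<Union> (I ` {..<m})" by auto
  qed
qed

lemma interval_part_block: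
  assumes "b \<le> M"
  shows "interval_part {int a..<int b} (trig_sum {0..<M} x) = trig_sum {a..<b} x"
proof -
  have "{k \<in> {0..<M}. int k \<in> {int a..<int b}} = {a..<b}" using assms by auto
  then show ?thesis by (simp add: interval_part_trig_sum)
qed

lemma interval_part_nth_block:
  "i < m \<Longrightarrow> interval_part {int (i * l)..<int (i * l + l)} (trig_sum {0..<m * l} x) =
    trig_sum {i * l..<i * l + l} x"
  using mult_right_mono[of "Suc i" m l] by (intro interval_part_block) simp

theorem theorem3p1:
  fixes p q0 q1 \<gamma>0 \<gamma>1 :: real
  assumes "1 < p" and "1 < q0" and "1 < q1"
    and "0 \<le> \<gamma>0" and "\<gamma>0 < 1 / hoelder_conj q0"
    and "0 \<le> \<gamma>1" and "\<gamma>1 < 1 / q1"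
    and upper: "\<exists>U>0. \<forall>\<I>. disjoint_intervals \<I> \<longrightarrow>
        (\<forall>f \<in> (trig_polys :: (real \<Rightarrow> 'a::complex_banach) set).
          {n. fourier_coeff f n \<noteq> 0} \<subseteq> \<Union>\<I> \<longrightarrow>
          Lp_norm p f \<le> U * real (card \<I>) powr \<gamma>0 *
            (\<Sum>I\<in>\<I>. Lp_norm p (interval_part I f) powr q0) powr (1 / q0))"
    and lower: "\<exists>L>0. \<forall>\<I>. disjoint_intervals \<I> \<longrightarrow>
        (\<forall>f \<in> (trig_polys :: (real \<Rightarrow> 'a) set).
          {n. fourier_coeff f n \<noteq> 0} \<subseteq> \<Union>\<I> \<longrightarrow>
          (\<Sum>I\<in>\<I>. Lp_norm p (interval_part I f) powr q1) powr (1 / q1)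
            \<le> L * real (card \<I>) powr \<gamma>1 * Lp_norm p f)"
  shows "\<forall>K. \<exists>C>0. \<exists>\<beta>>0. \<forall>T :: 'a \<Rightarrow> 'a.
      bounded_clinear T \<and> strongly_Kreiss_bounded K T \<longrightarrow>
      (\<forall>n\<ge>1. onorm (T ^^ n) \<le>
        C * real n powr (1 / 2 * (1 / q0 - 1 / q1 + \<gamma>0 + \<gamma>1)) * ln (real n + 2) powr \<beta>)"
proof
  fix K :: real
  obtain U where U: "U > 0" and upper': "\<And>\<I> f. disjoint_intervals \<I> \<Longrightarrow> f \<in> (trig_polys :: (real \<Rightarrow> 'a) set) \<Longrightarrow>
      {n. fourier_coeff f n \<noteq> 0} \<subseteq> \<Union>\<I> \<Longrightarrow>
      Lp_norm p f \<le> U * real (card \<I>) powr \<gamma>0 * (\<Sum>I\<in>\<I>. Lp_norm p (interval_part I f) powr q0) powr (1 / q0)"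
    using upper by blast
  obtain L where L: "L > 0" and lower': "\<And>\<I> f. disjoint_intervals \<I> \<Longrightarrow> f \<in> (trig_polys :: (real \<Rightarrow> 'a) set) \<Longrightarrow>
      {n. fourier_coeff f n \<noteq> 0} \<subseteq> \<Union>\<I> \<Longrightarrow>
      (\<Sum>I\<in>\<I>. Lp_norm p (interval_part I f) powr q1) powr (1 / q1) \<le> L * real (card \<I>) powr \<gamma>1 * Lp_norm p f"
    using lower by blast
  \<comment> \<open>An interval and its two complementary half-lines form a family of three, so
    condition (2) bounds the projection by \<open>L * 3 powr \<gamma>1\<close>.\<close>
  define R where "R = max 1 (L * 3 powr \<gamma>1)"
  have spec: "{n. fourier_coeff (trig_sum A x) n \<noteq> 0} \<subseteq> S" if "finite A" "int ` A \<subseteq> S" for A S and x :: "nat \<Rightarrow> 'a"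
    using spectrum_trig_sum[OF that(1), of x] that(2) by blast
  interpret interval_estimates "TYPE('a)" p R U L "\<gamma>0 + 1 / q0" "\<gamma>1 + (1 - 1 / q1)"
  proof
    fix a b M :: nat and x :: "nat \<Rightarrow> 'a"
    assume b: "b \<le> M"
    let ?f = "trig_sum {0..<M} x"
    show "Lp_norm p (trig_sum {a..<b} x) \<le> R * Lp_norm p ?f"
    proof (cases "a < b")
      \<comment> \<open>For \<open>b < a\<close> the half-lines would overlap; the projection is
        zero in this case.\<close>
      case False
      then show ?thesis using \<open>1 < p\<close> by (simp add: trig_sum_def[abs_def] R_def)
    next
      case True
      let ?I = "{int a..<int b}"
      let ?S = "{?I, {..<int a}, {int b..}}"
      have "card ?S \<le> 3" by (simp add: card_insert_if)
      have "Lp_norm p (trig_sum {a..<b} x) = (Lp_norm p (interval_part ?I ?f) powr q1) powr (1 / q1)"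
        using \<open>1 < q1\<close> by (simp add: interval_part_block[OF b] powr_powr)
      also have "\<dots> \<le> (\<Sum>I\<in>?S. Lp_norm p (interval_part I ?f) powr q1) powr (1 / q1)"
        using \<open>1 < q1\<close> by (intro powr_mono2 member_le_sum) auto
      also have "\<dots> \<le> L * real (card ?S) powr \<gamma>1 * Lp_norm p ?f"
      proof (rule lower')
        show "disjoint_intervals ?S"
          unfolding disjoint_intervals_def disjoint_def int_interval_def using True by auto
      qed (auto intro!: trig_sum_in_trig_polys)
      also have "\<dots> \<le> L * 3 powr \<gamma>1 * Lp_norm p ?f"
        using L \<open>0 \<le> \<gamma>1\<close> \<open>card ?S \<le> 3\<close> by (intro mult_right_mono mult_left_mono powr_mono2) auto
      also have "\<dots> \<le> R * Lp_norm p ?f"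
        by (intro mult_right_mono) (auto simp: R_def)
      finally show ?thesis .
    qed
  next
    fix m l :: nat and x :: "nat \<Rightarrow> 'a" and B :: real
    assume l: "1 \<le> l" and B: "0 \<le> B"
      and blocks: "\<And>i. i < m \<Longrightarrow> Lp_norm p (trig_sum {i * l..<i * l + l} x) \<le> B"
    let ?I = "\<lambda>i. {int (i * l)..<int (i * l + l)}"
    let ?f = "trig_sum {0..<m * l} x"
    note I = disjoint_intervals_blocks[OF l, of m]
    have "Lp_norm p ?f \<le> U * real (card (?I ` {..<m})) powr \<gamma>0 *
        (\<Sum>J\<in>?I ` {..<m}. Lp_norm p (interval_part J ?f) powr q0) powr (1 / q0)"
      by (rule upper'[OF I(1)]) (simp_all only: I(3) finite_atLeastLessThan spec trig_sum_in_trig_polys subset_refl)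
    also have "\<dots> = U * real m powr \<gamma>0 * (\<Sum>i<m. Lp_norm p (trig_sum {i * l..<i * l + l} x) powr q0) powr (1 / q0)"
      by (simp add: card_image[OF I(2)] sum.reindex[OF I(2)] interval_part_nth_block del: of_nat_add of_nat_mult)
    also have "\<dots> \<le> U * real m powr \<gamma>0 * (\<Sum>i<m. B powr q0) powr (1 / q0)"
      using U \<open>1 < q0\<close>
      by (intro mult_left_mono powr_mono2 sum_mono blocks) (auto intro: sum_nonneg)
    also have "\<dots> = U * real m powr (\<gamma>0 + 1 / q0) * B"
      using B \<open>1 < q0\<close> by (simp add: powr_mult powr_powr powr_add)
    finally show "Lp_norm p ?f \<le> U * real m powr (\<gamma>0 + 1 / q0) * B" .
  next
    fix m l :: nat and x :: "nat \<Rightarrow> 'a"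
    assume l: "1 \<le> l"
    let ?I = "\<lambda>i. {int (i * l)..<int (i * l + l)}"
    let ?f = "trig_sum {0..<m * l} x"
    note I = disjoint_intervals_blocks[OF l, of m]
    let ?N = "\<lambda>i. Lp_norm p (trig_sum {i * l..<i * l + l} x)"
    have "(\<Sum>J\<in>?I ` {..<m}. Lp_norm p (interval_part J ?f) powr q1) powr (1 / q1) \<le>
        L * real (card (?I ` {..<m})) powr \<gamma>1 * Lp_norm p ?f"
      by (rule lower'[OF I(1)]) (simp_all only: I(3) finite_atLeastLessThan spec trig_sum_in_trig_polys subset_refl)
    then have *: "(\<Sum>i<m. ?N i powr q1) powr (1 / q1) \<le> L * real m powr \<gamma>1 * Lp_norm p ?f"
      by (simp add: card_image[OF I(2)] sum.reindex[OF I(2)] interval_part_nth_block del: of_nat_add of_nat_mult)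
    show "(\<Sum>i<m. ?N i) \<le> L * real m powr (\<gamma>1 + (1 - 1 / q1)) * Lp_norm p ?f"
    proof (cases "m = 0")
      case False
      then have "(\<Sum>i<m. ?N i) \<le> real m powr (1 - 1 / q1) * (\<Sum>i<m. ?N i powr q1) powr (1 / q1)"
        using \<open>1 < q1\<close> by (intro sum_le_power_mean) auto
      also have "\<dots> \<le> real m powr (1 - 1 / q1) * (L * real m powr \<gamma>1 * Lp_norm p ?f)"
        by (intro mult_left_mono *) auto
      also have "\<dots> = L * (real m powr \<gamma>1 * real m powr (1 - 1 / q1)) * Lp_norm p ?f"
        by (simp only: mult_ac)
      finally show ?thesis by (simp only: powr_add)
    qed simp
  qed (use assms U L in \<open>auto simp: R_def\<close>)
  have e: "\<gamma>0 + 1 / q0 + (\<gamma>1 + (1 - 1 / q1)) - 1 = 1 / q0 - 1 / q1 + \<gamma>0 + \<gamma>1" by simp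
  \<comment> \<open>\<open>K\<close> is an arbitrary real number, whereas the estimates multiply by
    \<open>K + 1\<close> and need it to be at least 1; enlarging \<open>K\<close> weakens the
    hypothesis on \<open>T\<close>.\<close>
  from power_growth[of "max K 0", unfolded e, OF max.cobounded2]
  show "\<exists>C>0. \<exists>\<beta>>0. \<forall>T :: 'a \<Rightarrow> 'a. bounded_clinear T \<and> strongly_Kreiss_bounded K T \<longrightarrow>
      (\<forall>n\<ge>1. onorm (T ^^ n) \<le>
        C * real n powr (1 / 2 * (1 / q0 - 1 / q1 + \<gamma>0 + \<gamma>1)) * ln (real n + 2) powr \<beta>)"
    using strongly_Kreiss_bounded_mono[of K _ "max K 0"] by (meson max.cobounded1)
qed

end
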